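(* Let $\nu>0$ and let $\mathcal{S}^\nu$ be the integral transform $$\mathcal{S}^\nu(F)(Z)=\frac{\nu}{2\pi}\int_{\mathbb{C}}F(\xi)\,e^{\frac{\nu}{2}Z\overline{\xi}-\frac{\nu}{2}|\xi|^2}\,d\lambda(\xi),\qquad Z\in\mathbb{T}.$$ Then $\mathcal{S}^\nu$ maps $\mathcal{F}^{2,\frac{\nu}{2}}_{\mathbb{T}}(\mathbb{C})$ onto $\mathcal{F}^{2,\nu}(\mathbb{T})$, and maps $\mathcal{F}^{2,\frac{\nu}{2}}(\mathbb{C})$ onto $\mathcal{F}^{2,\nu}_i(\mathbb{T})$. Moreover, for every integer $n\ge0$, with $e_n(\xi):=\xi^n$, one has $\mathcal{S}^\nu(e_n)(Z)=Z^n$ for all $Z\in\mathbb{T}$.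
   Context: Bicomplex numbers: $\mathbb{T}=\{Z=z_1+jz_2:\ z_1,z_2\in\mathbb{C}\}$ is the commutative algebra in which $i^2=j^2=-1$, $ij=ji$ and $\mathbb{C}=\mathbb{R}+i\mathbb{R}$. Put $e_\pm=\frac{1\pm ij}{2}$; then $e_\pm^2=e_\pm$, $e_+e_-=0$, $e_++e_-=1$. Every $Z=z_1+jz_2$ is uniquely $Z=\alpha e_++\beta e_-$ with $\alpha=z_1-iz_2$, $\beta=z_1+iz_2\in\mathbb{C}$; algebraic operations are componentwise in $(\alpha,\beta)$, and $e^Z=e^\alpha e_++e^\beta e_-$. Set $Z^*=\overline{\alpha}e_++\overline{\beta}e_-$ and $|Z|^2=|z_1|^2+|z_2|^2=\frac{|\alpha|^2+|\beta|^2}{2}$. $\mathbb{C}$ is identified with $\mathbb{C}+j\{0\}\subset\mathbb{T}$. $\lambda$ denotes Lebesgue measure on $\mathbb{C}$, respectively on $\mathbb{T}\equiv\mathbb{R}^4$ (real coordinates of $z_1,z_2$). $\mathcal{H}^{2,\nu}(\mathbb{T})$ is the space of Borel measurable $f:\mathbb{T}\to\mathbb{T}$ (modulo a.e. equality) with $\|f\|_{\mathcal{H}^{2,\nu}(\mathbb{T})}<\infty$, where $\langle f,g\rangle=\left(\frac{\nu}{\pi}\right)^2\int_{\mathbb{T}} f(Z)g(Z)^*e^{-\nu|Z|^2}d\lambda(Z)$ and, writing $\langle f,f\rangle=a\,e_++b\,e_-$ with $a,b\ge0$, $\|f\|^2_{\mathcal{H}^{2,\nu}(\mathbb{T})}=\frac{a+b}{2}$.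 A function $f:\mathbb{T}\to\mathbb{T}$ is bicomplex holomorphic if for every $Z_0\in\mathbb{T}$ the limit of $\frac{f(Z_0+H)-f(Z_0)}{H}$ as $H\to0$, $H\notin\mathcal{NC}$, exists and is finite, where $\mathcal{NC}=\{\alpha e_++\beta e_-:\alpha\beta=0\}$. The bicomplex Bargmann space $\mathcal{F}^{2,\nu}(\mathbb{T})$ is the set of bicomplex holomorphic functions on $\mathbb{T}$ belonging to $\mathcal{H}^{2,\nu}(\mathbb{T})$. $\mathcal{F}^{2,\nu}_i(\mathbb{T})$ is the set of $f\in\mathcal{F}^{2,\nu}(\mathbb{T})$ with $f(\mathbb{C}+j\{0\})\subset\mathbb{C}+j\{0\}$. $\mathcal{F}^{2,\frac{\nu}{2}}(\mathbb{C})$ is the classical Bargmann space of entire functions $\phi:\mathbb{C}\to\mathbb{C}$ with $\frac{\nu}{2\pi}\int_{\mathbb{C}}|\phi(\xi)|^2e^{-\frac{\nu}{2}|\xi|^2}d\lambda(\xi)<\infty$. $\mathcal{F}^{2,\frac{\nu}{2}}_{\mathbb{T}}(\mathbb{C})$ is its $\mathbb{T}$-valued analog: the functions $F=\phi^+e_++\phi^-e_-:\mathbb{C}\to\mathbb{T}$ with $\phi^\pm\in\mathcal{F}^{2,\frac{\nu}{2}}(\mathbb{C})$. *)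

theory Defs
  imports "HOL-Complex_Analysis.Complex_Analysis"
begin

section \<open>Bicomplex numbers\<close>

text \<open>
  The pair (z1, z2) stands for z1 + j z2. The product type already supplies the
  vector space structure, the Euclidean norm with |Z|^2 = |z1|^2 + |z2|^2, the Borel sets, and
  Lebesgue measure \<^const>\<open>lborel\<close> in the real coordinates of z1 and z2.
\<close>

type_synonym bicomplex = "complex \<times> complex"

definition bc_of_complex :: "complex \<Rightarrow> bicomplex" where
  "bc_of_complex z = (z, 0)"

definition bc_mult :: "bicomplex \<Rightarrow> bicomplex \<Rightarrow> bicomplex" (infixl "\<odot>" 70) where
  "Z \<odot> W = (fst Z * fst W - snd Z * snd W, fst Z * snd W + snd Z * fst W)"

primrec bc_power :: "bicomplex \<Rightarrow> nat \<Rightarrow> bicomplex" where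
  "bc_power Z 0 = bc_of_complex 1"
| "bc_power Z (Suc n) = Z \<odot> bc_power Z n"

text \<open>The idempotents (1 + ij)/2 and (1 - ij)/2; note that ij is the pair (0, i).\<close>

definition bc_eplus :: bicomplex where "bc_eplus = (1 / 2, \<i> / 2)"
definition bc_eminus :: bicomplex where "bc_eminus = (1 / 2, - \<i> / 2)"

definition bc_alpha :: "bicomplex \<Rightarrow> complex" where "bc_alpha Z = fst Z - \<i> * snd Z"
definition bc_beta :: "bicomplex \<Rightarrow> complex" where "bc_beta Z = fst Z + \<i> * snd Z"

definition bc_idem :: "complex \<Rightarrow> complex \<Rightarrow> bicomplex" where
  "bc_idem a b = bc_of_complex a \<odot> bc_eplus + bc_of_complex b \<odot> bc_eminus"

definition bc_star :: "bicomplex \<Rightarrow> bicomplex" where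
  "bc_star Z = bc_idem (cnj (bc_alpha Z)) (cnj (bc_beta Z))"

definition bc_exp :: "bicomplex \<Rightarrow> bicomplex" where
  "bc_exp Z = bc_idem (exp (bc_alpha Z)) (exp (bc_beta Z))"

definition bc_null_cone :: "bicomplex set" where
  "bc_null_cone = {bc_idem a b | a b. a * b = 0}"

text \<open>Meaningful for a divisor outside the null cone; \<open>bc_divide_mult\<close> below.\<close>

definition bc_divide :: "bicomplex \<Rightarrow> bicomplex \<Rightarrow> bicomplex" where
  "bc_divide Z W = bc_idem (bc_alpha Z / bc_alpha W) (bc_beta Z / bc_beta W)"

lemma bc_idempotents:
  "bc_eplus \<odot> bc_eplus = bc_eplus" "bc_eminus \<odot> bc_eminus = bc_eminus"
  "bc_eplus \<odot> bc_eminus = 0" "bc_eplus + bc_eminus = bc_of_complex 1"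
  by (auto simp: bc_eplus_def bc_eminus_def bc_mult_def bc_of_complex_def prod_eq_iff)

lemma bc_idem_eq: "bc_idem a b = ((a + b) / 2, \<i> * (a - b) / 2)"
  by (simp add: bc_idem_def bc_of_complex_def bc_mult_def bc_eplus_def bc_eminus_def field_simps)

lemma bc_alpha_idem [simp]: "bc_alpha (bc_idem a b) = a"
  and bc_beta_idem [simp]: "bc_beta (bc_idem a b) = b"
  by (simp_all add: bc_alpha_def bc_beta_def bc_idem_eq field_simps)

lemma bc_idem_alpha_beta [simp]: "bc_idem (bc_alpha Z) (bc_beta Z) = Z"
  by (simp add: bc_alpha_def bc_beta_def bc_idem_eq prod_eq_iff)

lemma bc_alpha_mult [simp]: "bc_alpha (Z \<odot> W) = bc_alpha Z * bc_alpha W"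
  and bc_beta_mult [simp]: "bc_beta (Z \<odot> W) = bc_beta Z * bc_beta W"
  by (simp_all add: bc_alpha_def bc_beta_def bc_mult_def algebra_simps)

lemma bc_eq_iff: "Z = W \<longleftrightarrow> bc_alpha Z = bc_alpha W \<and> bc_beta Z = bc_beta W"
  by (metis bc_idem_alpha_beta)

lemma bc_norm_sq_alpha_beta: "(norm Z)\<^sup>2 = ((cmod (bc_alpha Z))\<^sup>2 + (cmod (bc_beta Z))\<^sup>2) / 2"
  by (cases Z, simp add: norm_prod_def bc_alpha_def bc_beta_def cmod_power2,
      simp add: power2_eq_square algebra_simps)

lemma bc_null_cone_iff: "Z \<in> bc_null_cone \<longleftrightarrow> bc_alpha Z = 0 \<or> bc_beta Z = 0"
  unfolding bc_null_cone_def by (force simp: bc_eq_iff)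

lemma bc_divide_mult: "W \<notin> bc_null_cone \<Longrightarrow> bc_divide Z W \<odot> W = Z"
  by (simp add: bc_null_cone_iff bc_eq_iff bc_divide_def)


section \<open>The Hilbert space of bicomplex functions\<close>

definition bc_inner_integrand ::
  "real \<Rightarrow> (bicomplex \<Rightarrow> bicomplex) \<Rightarrow> (bicomplex \<Rightarrow> bicomplex) \<Rightarrow> bicomplex \<Rightarrow> bicomplex" where
  "bc_inner_integrand \<nu> f g Z = exp (- \<nu> * (norm Z)\<^sup>2) *\<^sub>R (f Z \<odot> bc_star (g Z))"

definition bc_inner ::
  "real \<Rightarrow> (bicomplex \<Rightarrow> bicomplex) \<Rightarrow> (bicomplex \<Rightarrow> bicomplex) \<Rightarrow> bicomplex" where
  "bc_inner \<nu> f g = (\<nu> / pi)\<^sup>2 *\<^sub>R (\<integral>Z. bc_inner_integrand \<nu> f g Z \<partial>lborel)"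

text \<open>
  Both idempotent components of f f* are real and nonnegative, so the components a and b of the
  inner product of f with itself make sense in [0, \<infinity>] for every Borel function f; the squared norm
  (a + b)/2 is defined with these extended values. When it is finite, it is the value obtained from
  the Bochner integral \<^const>\<open>bc_inner\<close> (lemma \<open>bc_norm2_eq_inner\<close>).
\<close>

definition bc_norm2 :: "real \<Rightarrow> (bicomplex \<Rightarrow> bicomplex) \<Rightarrow> ennreal" where
  "bc_norm2 \<nu> f =
     (let a = ennreal ((\<nu> / pi)\<^sup>2) *
                (\<integral>\<^sup>+Z. ennreal (Re (bc_alpha (bc_inner_integrand \<nu> f f Z))) \<partial>lborel);
          b = ennreal ((\<nu> / pi)\<^sup>2) *
                (\<integral>\<^sup>+Z. ennreal (Re (bc_beta (bc_inner_integrand \<nu> f f Z))) \<partial>lborel)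
      in (a + b) / 2)"

definition bc_hilbert :: "real \<Rightarrow> (bicomplex \<Rightarrow> bicomplex) set" where
  "bc_hilbert \<nu> = {f. f \<in> borel_measurable borel \<and> bc_norm2 \<nu> f < \<infinity>}"

lemma bc_alpha_inner_integrand:
  "bc_alpha (bc_inner_integrand \<nu> f f Z) =
     complex_of_real (exp (- \<nu> * (norm Z)\<^sup>2) * (cmod (bc_alpha (f Z)))\<^sup>2)"
proof -
  have "bc_alpha (c *\<^sub>R W) = c *\<^sub>R bc_alpha W" for c W
    by (simp add: bc_alpha_def scaleR_diff_right)
  then show ?thesis
    by (simp add: bc_inner_integrand_def bc_star_def complex_norm_square[symmetric] scaleR_conv_of_real
        del: of_real_exp)
qed

lemma bc_beta_inner_integrand:
  "bc_beta (bc_inner_integrand \<nu> f f Z) =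
     complex_of_real (exp (- \<nu> * (norm Z)\<^sup>2) * (cmod (bc_beta (f Z)))\<^sup>2)"
proof -
  have "bc_beta (c *\<^sub>R W) = c *\<^sub>R bc_beta W" for c W
    by (simp add: bc_beta_def scaleR_add_right)
  then show ?thesis
    by (simp add: bc_inner_integrand_def bc_star_def complex_norm_square[symmetric] scaleR_conv_of_real
        del: of_real_exp)
qed

lemma bc_norm2_eq_inner:
  assumes \<nu>: "\<nu> > 0" and f: "f \<in> bc_hilbert \<nu>"
  shows "bc_norm2 \<nu> f = ennreal ((Re (bc_alpha (bc_inner \<nu> f f)) + Re (bc_beta (bc_inner \<nu> f f))) / 2)"
proof -
  define A where "A Z = exp (- \<nu> * (norm Z)\<^sup>2) * (cmod (bc_alpha (f Z)))\<^sup>2" for Z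
  define B where "B Z = exp (- \<nu> * (norm Z)\<^sup>2) * (cmod (bc_beta (f Z)))\<^sup>2" for Z
  have [measurable]: "f \<in> borel_measurable borel"
    using f by (simp add: bc_hilbert_def)
  have [measurable]: "(fst :: bicomplex \<Rightarrow> complex) \<in> borel_measurable borel"
      "(snd :: bicomplex \<Rightarrow> complex) \<in> borel_measurable borel"
    by (intro borel_measurable_continuous_onI continuous_on_fst continuous_on_snd continuous_on_id)+
  have [measurable]: "A \<in> borel_measurable borel" "B \<in> borel_measurable borel"
    unfolding A_def B_def bc_alpha_def bc_beta_def by measurable
  have nn: "A Z \<ge> 0" "B Z \<ge> 0" for Z by (auto simp: A_def B_def)
  have eq: "bc_norm2 \<nu> f = (ennreal ((\<nu> / pi)\<^sup>2) * (\<integral>\<^sup>+Z. ennreal (A Z) \<partial>lborel)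
      + ennreal ((\<nu> / pi)\<^sup>2) * (\<integral>\<^sup>+Z. ennreal (B Z) \<partial>lborel)) / 2"
    by (simp add: bc_norm2_def Let_def bc_alpha_inner_integrand bc_beta_inner_integrand A_def B_def
        del: of_real_mult)
  have "ennreal ((\<nu> / pi)\<^sup>2) > 0"
    using \<nu> by simp
  moreover have "bc_norm2 \<nu> f \<noteq> \<infinity>"
    using f by (auto simp: bc_hilbert_def)
  ultimately have fin: "(\<integral>\<^sup>+Z. ennreal (A Z) \<partial>lborel) < \<infinity>" "(\<integral>\<^sup>+Z. ennreal (B Z) \<partial>lborel) < \<infinity>"
    unfolding eq by (auto simp: ennreal_divide_eq_top_iff ennreal_mult_eq_top_iff less_top)
  have iA: "integrable lborel A" and iB: "integrable lborel B"
    by (rule integrableI_nonneg; use fin nn in simp)+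
  have AB: "bc_alpha (bc_inner_integrand \<nu> f f Z) = of_real (A Z)"
      "bc_beta (bc_inner_integrand \<nu> f f Z) = of_real (B Z)" for Z
    by (simp_all only: bc_alpha_inner_integrand bc_beta_inner_integrand A_def B_def)
  have F: "bc_inner_integrand \<nu> f f Z = bc_idem (of_real (A Z)) (of_real (B Z))" for Z
    by (simp add: bc_eq_iff AB)
  have bl: "bounded_linear bc_alpha" "bounded_linear bc_beta"
    unfolding bc_alpha_def[abs_def] bc_beta_def[abs_def]
    by (auto intro!: bounded_linear_intros)
  have "bc_idem (of_real x) (of_real y) = x *\<^sub>R bc_eplus + y *\<^sub>R bc_eminus" for x y
    by (simp add: bc_idem_eq bc_eplus_def bc_eminus_def scaleR_conv_of_real field_simps)
  then have i: "integrable lborel (bc_inner_integrand \<nu> f f)"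
    unfolding F[abs_def] using iA iB by simp
  have "bc_alpha (\<integral>Z. bc_inner_integrand \<nu> f f Z \<partial>lborel) = complex_of_real (\<integral>Z. A Z \<partial>lborel)"
    using integral_bounded_linear[OF bl(1) i] by (simp add: AB)
  then have a: "Re (bc_alpha (bc_inner \<nu> f f)) = (\<nu> / pi)\<^sup>2 * (\<integral>Z. A Z \<partial>lborel)"
    by (simp only: bc_inner_def linear_simps[OF bl(1)] scaleR_complex.sel Re_complex_of_real)
  have "bc_beta (\<integral>Z. bc_inner_integrand \<nu> f f Z \<partial>lborel) = complex_of_real (\<integral>Z. B Z \<partial>lborel)"
    using integral_bounded_linear[OF bl(2) i] by (simp add: AB)
  then have b: "Re (bc_beta (bc_inner \<nu> f f)) = (\<nu> / pi)\<^sup>2 * (\<integral>Z. B Z \<partial>lborel)"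
    by (simp only: bc_inner_def linear_simps[OF bl(2)] scaleR_complex.sel Re_complex_of_real)
  have 1: "(\<integral>\<^sup>+Z. ennreal (A Z) \<partial>lborel) = ennreal (\<integral>Z. A Z \<partial>lborel)"
      "(\<integral>\<^sup>+Z. ennreal (B Z) \<partial>lborel) = ennreal (\<integral>Z. B Z \<partial>lborel)"
    using iA iB nn by (auto intro!: nn_integral_eq_integral)
  have 2: "(\<integral>Z. A Z \<partial>lborel) \<ge> 0" "(\<integral>Z. B Z \<partial>lborel) \<ge> 0"
    using nn by auto
  show ?thesis
    unfolding eq a b 1 using 2
    by (simp add: ennreal_mult[symmetric] ennreal_plus[symmetric] divide_ennreal[symmetric]
        del: ennreal_plus)
qed


section \<open>Bargmann spaces\<close>

definition bc_holomorphic :: "(bicomplex \<Rightarrow> bicomplex) \<Rightarrow> bool" where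
  "bc_holomorphic f \<longleftrightarrow>
     (\<forall>Z0. \<exists>L. ((\<lambda>H. bc_divide (f (Z0 + H) - f Z0) H) \<longlongrightarrow> L) (at 0 within - bc_null_cone))"

definition bc_bargmann :: "real \<Rightarrow> (bicomplex \<Rightarrow> bicomplex) set" where
  "bc_bargmann \<nu> = {f \<in> bc_hilbert \<nu>. bc_holomorphic f}"

definition bc_bargmann_i :: "real \<Rightarrow> (bicomplex \<Rightarrow> bicomplex) set" where
  "bc_bargmann_i \<nu> = {f \<in> bc_bargmann \<nu>. f ` range bc_of_complex \<subseteq> range bc_of_complex}"

definition bargmann :: "real \<Rightarrow> (complex \<Rightarrow> complex) set" where
  "bargmann \<mu> = {\<phi>. \<phi> holomorphic_on UNIV \<and>
     ennreal (\<mu> / pi) *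
       (\<integral>\<^sup>+\<xi>. ennreal ((cmod (\<phi> \<xi>))\<^sup>2 * exp (- \<mu> * (cmod \<xi>)\<^sup>2)) \<partial>lborel) < \<infinity>}"

definition bargmann_bc :: "real \<Rightarrow> (complex \<Rightarrow> bicomplex) set" where
  "bargmann_bc \<mu> = {\<lambda>\<xi>. bc_idem (\<phi> \<xi>) (\<psi> \<xi>) | \<phi> \<psi>. \<phi> \<in> bargmann \<mu> \<and> \<psi> \<in> bargmann \<mu>}"


section \<open>The integral transform\<close>

definition bc_transform_integrand ::
  "real \<Rightarrow> (complex \<Rightarrow> bicomplex) \<Rightarrow> bicomplex \<Rightarrow> complex \<Rightarrow> bicomplex" where
  "bc_transform_integrand \<nu> F Z \<xi> =
     F \<xi> \<odot> bc_exp ((\<nu> / 2) *\<^sub>R (Z \<odot> bc_of_complex (cnj \<xi>))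
                    - bc_of_complex (complex_of_real (\<nu> / 2 * (cmod \<xi>)\<^sup>2)))"

definition bc_transform :: "real \<Rightarrow> (complex \<Rightarrow> bicomplex) \<Rightarrow> bicomplex \<Rightarrow> bicomplex" where
  "bc_transform \<nu> F Z =
     (\<nu> / (2 * pi)) *\<^sub>R (\<integral>\<xi>. bc_transform_integrand \<nu> F Z \<xi> \<partial>lborel)"

end

theory Submission
  imports Defs "HOL-Probability.Distributions"
begin

text \<open>
  In the idempotent coordinates \<open>Z = \<alpha> e\<^sub>+ + \<beta> e\<^sub>-\<close> everything splits into two copies of the classical
  Bargmann theory, and the transform becomes the identity on each copy:
  if \<open>F = \<phi> e\<^sub>+ + \<psi> e\<^sub>-\<close>, then the two components of the transform at \<open>Z\<close> are the Gaussian integrals of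
  \<open>\<phi>\<close> and \<open>\<psi>\<close> against the reproducing kernel at \<open>\<alpha>\<close> and at \<open>\<beta>\<close>, so its value is
  \<open>\<phi>(\<alpha>) e\<^sub>+ + \<psi>(\<beta>) e\<^sub>-\<close> (lemma \<open>bc_transform_idem\<close>). The theorem thus says that the bicomplex Bargmann
  space consists exactly of the functions \<open>Z \<mapsto> \<phi>(\<alpha>) e\<^sub>+ + \<psi>(\<beta>) e\<^sub>-\<close> with \<open>\<phi>\<close> and \<open>\<psi>\<close> in the classical one
  (lemma \<open>bc_bargmann_eq\<close>). Such a function sends \<open>\<complex>\<close> to \<open>\<complex>\<close> iff \<open>\<phi> = \<psi>\<close>, and
  \<open>Z\<^sup>n = \<alpha>\<^sup>n e\<^sub>+ + \<beta>\<^sup>n e\<^sub>-\<close>; these give the other two claims.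

  The reproducing property comes from completing the square. After the translation \<open>\<xi> = z + w\<close> the
  integrand is a Gaussian in \<open>w\<close> times an entire function of \<open>w\<close> with value \<open>\<phi>(z)\<close> at \<open>0\<close>, and the Gaussian mean of
  an entire function is its value at the origin: by rotation invariance of Lebesgue measure the function may be
  averaged over circles first, which is Cauchy's formula (lemma \<open>gaussian_mean_value\<close>).

  The description of the Bargmann space has an analytic and a measure-theoretic half. Convergence of the
  bicomplex difference quotient along all \<open>H\<close> outside the null cone forces the \<open>e\<^sub>+\<close> component to be
  independent of \<open>\<beta>\<close>, and symmetrically for the other one (lemma \<open>independent_of_second_variable\<close>). The
  norm splits because \<open>|Z|\<^sup>2 = (|\<alpha>|\<^sup>2 + |\<beta>|\<^sup>2) / 2\<close> makes the weight a product of two Gaussians, and the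
  linear map \<open>Z \<mapsto> (\<alpha>, \<beta>)\<close> multiplies volumes by 4 (lemma \<open>nn_integral_idempotent_coordinates\<close>).
\<close>

section \<open>Lebesgue measure and Gaussians on the complex plane\<close>

lemma lborel_complex_eq_distr:
  "(lborel :: complex measure) = distr (lborel \<Otimes>\<^sub>M lborel) borel (\<lambda>(x, y). Complex x y)"
proof (rule lborel_eqI)
  fix l u :: complex
  assume le: "\<And>b. b \<in> Basis \<Longrightarrow> l \<bullet> b \<le> u \<bullet> b"
  have *: "Re l \<le> Re u" "Im l \<le> Im u"
    using le[of 1] le[of \<i>] by (auto simp: Basis_complex_def)
  have m: "(\<lambda>(x, y). Complex x y) \<in> borel_measurable (lborel \<Otimes>\<^sub>M lborel)"
    unfolding Complex_eq case_prod_beta by measurable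
  have v: "(\<lambda>(x, y). Complex x y) -` box l u \<inter> space (lborel \<Otimes>\<^sub>M lborel) = box (Re l) (Re u) \<times> box (Im l) (Im u)"
    by (auto simp: box_def Basis_complex_def space_pair_measure)
  have "emeasure (distr (lborel \<Otimes>\<^sub>M lborel) borel (\<lambda>(x, y). Complex x y)) (box l u)
    = emeasure (lborel \<Otimes>\<^sub>M lborel) (box (Re l) (Re u) \<times> box (Im l) (Im u))"
    by (subst emeasure_distr[OF m]) (auto simp only: v borel_open[OF open_box])
  also have "\<dots> = ennreal ((Re u - Re l) * (Im u - Im l))"
    using * by (simp add: lborel.emeasure_pair_measure_Times ennreal_mult)
  also have "\<dots> = ennreal (\<Prod>b\<in>Basis. (u - l) \<bullet> b)"
    by (simp add: Basis_complex_def inner_complex_def)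
  finally show "emeasure (distr (lborel \<Otimes>\<^sub>M lborel) borel (\<lambda>(x, y). Complex x y)) (box l u)
    = ennreal (\<Prod>b\<in>Basis. (u - l) \<bullet> b)" .
qed simp

lemma nn_integral_lborel_complex:
  assumes [measurable]: "f \<in> borel_measurable borel"
  shows "(\<integral>\<^sup>+w. f w \<partial>lborel) = (\<integral>\<^sup>+y. \<integral>\<^sup>+x. f (Complex x y) \<partial>lborel \<partial>lborel)"
proof -
  have [measurable]: "(\<lambda>(x, y). Complex x y) \<in> borel_measurable (lborel \<Otimes>\<^sub>M lborel)"
    unfolding Complex_eq case_prod_beta by measurable
  show ?thesis
    by (subst lborel_complex_eq_distr, subst nn_integral_distr)
      (auto simp: lborel_pair.nn_integral_snd[symmetric])
qed

text \<open>
  Multiplication by \<open>c = a + i b\<close> is the matrix with rows \<open>(a, -b)\<close> and \<open>(b, a)\<close> and determinant \<open>|c|\<^sup>2\<close>. It is a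
  composition of shears and coordinate scalings, so Fubini and one-dimensional affine substitutions suffice.
\<close>

lemma nn_integral_complex_mult:
  fixes c :: complex
  assumes [measurable]: "f \<in> borel_measurable borel" and "c \<noteq> 0"
  shows "(\<integral>\<^sup>+w. f w \<partial>lborel) = ennreal ((cmod c)\<^sup>2) * (\<integral>\<^sup>+w. f (c * w) \<partial>lborel)"
proof -
  define a b where "a = Re c" and "b = Im c"
  have ab: "(cmod c)\<^sup>2 = a\<^sup>2 + b\<^sup>2" by (simp add: a_def b_def cmod_power2)
  have ne: "a\<^sup>2 + b\<^sup>2 \<noteq> 0"
    using \<open>c \<noteq> 0\<close> ab by (metis norm_eq_zero power_eq_0_iff)
  have c: "c * Complex x y = Complex (a * x - b * y) (b * x + a * y)" for x y
    by (simp add: a_def b_def complex_eq_iff)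
  have cm: "(\<lambda>p. Complex (u p) (v p)) \<in> borel_measurable M"
    if "u \<in> borel_measurable M" "v \<in> borel_measurable M" for u v and M :: "'z measure"
    using that unfolding Complex_eq by measurable
  note [measurable] = cm
  have m: "(\<lambda>w. f (c * w)) \<in> borel_measurable borel" by measurable
  have R: "(\<integral>\<^sup>+w. f (c * w) \<partial>lborel) = (\<integral>\<^sup>+y. \<integral>\<^sup>+x. f (Complex (a * x - b * y) (b * x + a * y)) \<partial>lborel \<partial>lborel)"
    by (simp add: nn_integral_lborel_complex[OF m] c)
  show ?thesis
  proof (cases "a = 0")
    case False
    \<comment> \<open>Substitute \<open>s = a x - b y\<close> for \<open>x\<close>, and then \<open>t = (b s + |c|\<^sup>2 y) / a\<close> for \<open>y\<close>.\<close>
    have 1: "(\<integral>\<^sup>+x. f (Complex x (b / a * x + (a\<^sup>2 + b\<^sup>2) / a * y)) \<partial>lborel)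
       = \<bar>a\<bar> * (\<integral>\<^sup>+x. f (Complex (a * x - b * y) (b * x + a * y)) \<partial>lborel)" for y
    proof -
      have "Complex (- b * y + a * x) (b / a * (- b * y + a * x) + (a\<^sup>2 + b\<^sup>2) / a * y)
        = Complex (a * x - b * y) (b * x + a * y)" for x
        using False by (simp add: field_simps power2_eq_square)
      then show ?thesis
        by (subst nn_integral_real_affine[where c=a and t="- b * y"]) (use False in auto)
    qed
    have 2: "(\<integral>\<^sup>+y. f (Complex x y) \<partial>lborel)
       = \<bar>(a\<^sup>2 + b\<^sup>2) / a\<bar> * (\<integral>\<^sup>+y. f (Complex x (b / a * x + (a\<^sup>2 + b\<^sup>2) / a * y)) \<partial>lborel)" for x
      by (subst nn_integral_real_affine[where c="(a\<^sup>2 + b\<^sup>2) / a" and t="b / a * x"]) (use False ne in auto)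
    have "(\<integral>\<^sup>+w. f w \<partial>lborel) = (\<integral>\<^sup>+x. \<integral>\<^sup>+y. f (Complex x y) \<partial>lborel \<partial>lborel)"
      by (subst nn_integral_lborel_complex, simp, rule lborel_pair.Fubini') measurable
    also have "\<dots> = (\<integral>\<^sup>+x. \<bar>(a\<^sup>2 + b\<^sup>2) / a\<bar> * (\<integral>\<^sup>+y. f (Complex x (b / a * x + (a\<^sup>2 + b\<^sup>2) / a * y)) \<partial>lborel) \<partial>lborel)"
      by (simp add: 2)
    also have "\<dots> = \<bar>(a\<^sup>2 + b\<^sup>2) / a\<bar> * (\<integral>\<^sup>+x. \<integral>\<^sup>+y. f (Complex x (b / a * x + (a\<^sup>2 + b\<^sup>2) / a * y)) \<partial>lborel \<partial>lborel)"
      by (rule nn_integral_cmult) measurable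
    also have "\<dots> = \<bar>(a\<^sup>2 + b\<^sup>2) / a\<bar> * (\<integral>\<^sup>+y. \<integral>\<^sup>+x. f (Complex x (b / a * x + (a\<^sup>2 + b\<^sup>2) / a * y)) \<partial>lborel \<partial>lborel)"
      by (intro arg_cong2[where f="(*)"] refl lborel_pair.Fubini'[symmetric]) measurable
    also have "\<dots> = \<bar>(a\<^sup>2 + b\<^sup>2) / a\<bar> * (\<bar>a\<bar> * (\<integral>\<^sup>+w. f (c * w) \<partial>lborel))"
      unfolding 1 R by (intro arg_cong2[where f="(*)"] refl nn_integral_cmult) measurable
    also have "\<dots> = ennreal ((cmod c)\<^sup>2) * (\<integral>\<^sup>+w. f (c * w) \<partial>lborel)"
      using False by (simp add: ab mult.assoc[symmetric] ennreal_mult[symmetric])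
    finally show ?thesis .
  next
    case True
    then have "b \<noteq> 0" using ne by auto
    have "(\<integral>\<^sup>+w. f w \<partial>lborel) = (\<integral>\<^sup>+y. \<bar>b\<bar> * (\<integral>\<^sup>+x. f (Complex (- b * x) y) \<partial>lborel) \<partial>lborel)"
      by (subst nn_integral_lborel_complex, simp, subst nn_integral_real_affine[where c="-b" and t=0])
        (use \<open>b \<noteq> 0\<close> in auto)
    also have "\<dots> = \<bar>b\<bar> * (\<integral>\<^sup>+y. \<integral>\<^sup>+x. f (Complex (- b * x) y) \<partial>lborel \<partial>lborel)"
      by (rule nn_integral_cmult) measurable
    also have "(\<integral>\<^sup>+y. \<integral>\<^sup>+x. f (Complex (- b * x) y) \<partial>lborel \<partial>lborel)
       = \<bar>b\<bar> * (\<integral>\<^sup>+y. \<integral>\<^sup>+x. f (Complex (- b * x) (b * y)) \<partial>lborel \<partial>lborel)"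
      by (subst nn_integral_real_affine[where c="b" and t=0]) (use \<open>b \<noteq> 0\<close> in auto)
    also have "(\<integral>\<^sup>+y. \<integral>\<^sup>+x. f (Complex (- b * x) (b * y)) \<partial>lborel \<partial>lborel) = (\<integral>\<^sup>+w. f (c * w) \<partial>lborel)"
      unfolding R by (simp add: True, rule lborel_pair.Fubini') measurable
    finally show ?thesis
      unfolding ab using True by (simp add: mult.assoc[symmetric] ennreal_mult[symmetric] power2_eq_square)
  qed
qed

lemma nn_integral_complex_affine:
  fixes c t :: complex
  assumes [measurable]: "f \<in> borel_measurable borel" and "c \<noteq> 0"
  shows "(\<integral>\<^sup>+w. f w \<partial>lborel) = ennreal ((cmod c)\<^sup>2) * (\<integral>\<^sup>+w. f (t + c * w) \<partial>lborel)"
proof -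
  have "(\<integral>\<^sup>+w. f w \<partial>lborel) = (\<integral>\<^sup>+w. f (t + w) \<partial>lborel)"
    by (subst lborel_distr_plus[of t, symmetric], subst nn_integral_distr) auto
  also have "\<dots> = ennreal ((cmod c)\<^sup>2) * (\<integral>\<^sup>+w. f (t + c * w) \<partial>lborel)"
    by (rule nn_integral_complex_mult) (use assms in auto)
  finally show ?thesis .
qed

lemma lborel_distr_rotation:
  fixes c :: complex
  assumes "cmod c = 1"
  shows "distr lborel borel (\<lambda>w. c * w) = lborel"
proof (rule measure_eqI)
  fix A assume "A \<in> sets (distr lborel borel (\<lambda>w. c * w))"
  then have [measurable]: "A \<in> sets borel" by simp
  have "emeasure (distr lborel borel (\<lambda>w. c * w)) A = (\<integral>\<^sup>+w. indicator A (c * w) \<partial>lborel)"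
    by (subst nn_integral_indicator[symmetric], simp, subst nn_integral_distr) auto
  also have "\<dots> = (\<integral>\<^sup>+w. indicator A w \<partial>lborel)"
    using assms by (subst (2) nn_integral_complex_mult[where c=c]) auto
  finally show "emeasure (distr lborel borel (\<lambda>w. c * w)) A = emeasure lborel A" by simp
qed simp

lemma nn_integral_gaussian_complex:
  assumes "\<mu> > 0"
  shows "(\<integral>\<^sup>+w. ennreal (exp (- \<mu> * (cmod w)\<^sup>2)) \<partial>lborel) = ennreal (pi / \<mu>)"
proof -
  define \<sigma> where "\<sigma> = 1 / sqrt (2 * \<mu>)"
  have \<sigma>: "\<sigma> > 0" "\<sigma>\<^sup>2 = 1 / (2 * \<mu>)"
    using assms by (auto simp: \<sigma>_def power_divide)
  have "exp (- \<mu> * x\<^sup>2) = sqrt (pi / \<mu>) * normal_density 0 \<sigma> x" for x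
    using assms by (simp add: normal_density_def \<sigma> real_sqrt_divide)
  then have 1: "(\<integral>\<^sup>+x. ennreal (exp (- \<mu> * x\<^sup>2)) \<partial>lborel) = ennreal (sqrt (pi / \<mu>))"
    using assms \<sigma>
    by (simp add: ennreal_mult nn_integral_cmult nn_integral_eq_integral)
  have "(\<integral>\<^sup>+w. ennreal (exp (- \<mu> * (cmod w)\<^sup>2)) \<partial>lborel)
    = (\<integral>\<^sup>+w. (\<Prod>b\<in>(Basis :: complex set). ennreal (exp (- \<mu> * (w \<bullet> b)\<^sup>2))) \<partial>lborel)"
    by (intro nn_integral_cong)
      (simp add: Basis_complex_def cmod_power2 inner_complex_def ennreal_mult[symmetric] exp_add[symmetric]
        distrib_left)
  also have "\<dots> = ennreal (sqrt (pi / \<mu>)) * ennreal (sqrt (pi / \<mu>))"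
    by (subst nn_integral_lborel_prod) (simp_all add: 1[simplified] Basis_complex_def)
  also have "\<dots> = ennreal (pi / \<mu>)"
    using assms by (simp add: ennreal_mult[symmetric])
  finally show ?thesis .
qed

section \<open>Mean values and the reproducing property\<close>

text \<open>
  Cauchy's formula on the unit circle for \<open>u \<mapsto> g (u w)\<close>. Scaling the function rather than the circle
  treats \<open>w = 0\<close> along with all other points.
\<close>

lemma circle_mean_value:
  fixes g :: "complex \<Rightarrow> complex"
  assumes g: "g holomorphic_on UNIV"
  shows "((\<lambda>t::real. g (exp (2 * of_real pi * \<i> * of_real t) * w)) has_integral g 0) {0..1}"
proof -
  have h: "(\<lambda>u. g (u * w)) holomorphic_on UNIV"
    by (rule holomorphic_on_compose_gen[OF _ g, unfolded o_def]) (auto intro!: holomorphic_intros)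
  have "((\<lambda>u. g (u * w) / (u - 0)) has_contour_integral (2 * of_real pi * \<i> * g (0 * w))) (circlepath 0 1)"
    by (rule Cauchy_integral_circlepath)
      (auto intro: holomorphic_on_subset[OF h] continuous_on_subset[OF holomorphic_on_imp_continuous_on[OF h]])
  then have "((\<lambda>t. g (circlepath 0 1 t * w) / circlepath 0 1 t
       * vector_derivative (circlepath 0 1) (at t within {0..1})) has_integral (2 * of_real pi * \<i> * g 0)) {0..1}"
    by (simp add: has_contour_integral_def)
  then have "((\<lambda>t::real. 2 * of_real pi * \<i> * g (exp (2 * of_real pi * \<i> * of_real t) * w))
      has_integral (2 * of_real pi * \<i> * g 0)) {0..1}"
  proof (rule has_integral_eq[rotated])
    fix t :: real assume "t \<in> {0..1}"
    then have "vector_derivative (circlepath 0 1) (at t within {0..1})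
        = 2 * of_real pi * \<i> * circlepath 0 1 t"
      by (simp add: vector_derivative_circlepath01) (simp add: circlepath)
    moreover have "circlepath 0 1 t \<noteq> 0"
      by (simp add: circlepath)
    ultimately show "g (circlepath 0 1 t * w) / circlepath 0 1 t
        * vector_derivative (circlepath 0 1) (at t within {0..1})
        = 2 * of_real pi * \<i> * g (exp (2 * of_real pi * \<i> * of_real t) * w)"
      by (simp add: circlepath)
  qed
  from has_integral_mult_right[OF this, of "1 / (2 * of_real pi * \<i>)"] show ?thesis
    by simp
qed

text \<open>
  The integral does not change when \<open>g w\<close> is replaced by \<open>g (e\<^sup>i\<^sup>\<theta> w)\<close>, because both Lebesgue measure and
  the weight are rotation invariant. Averaging over \<open>\<theta>\<close> and exchanging the integrals turns \<open>g\<close> into the constant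
  \<open>g 0\<close>, and the Gaussian has total mass \<open>\<pi> / \<mu>\<close>.
\<close>

lemma gaussian_mean_value:
  fixes g :: "complex \<Rightarrow> complex"
  assumes \<mu>: "\<mu> > 0" and g: "g holomorphic_on UNIV"
    and i: "integrable lborel (\<lambda>w. exp (- \<mu> * (cmod w)\<^sup>2) *\<^sub>R g w)"
  shows "(\<integral>w. exp (- \<mu> * (cmod w)\<^sup>2) *\<^sub>R g w \<partial>lborel) = (pi / \<mu>) *\<^sub>R g 0"
proof -
  define G where "G w = exp (- \<mu> * (cmod w)\<^sup>2)" for w :: complex
  define r where "r t = exp (2 * of_real pi * \<i> * of_real t)" for t :: real
  define h where "h t w = (indicator {0..1} t :: real) *\<^sub>R (G w *\<^sub>R g (r t * w))" for t w
  have cont: "continuous_on UNIV g"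
    by (rule holomorphic_on_imp_continuous_on[OF g])
  have [measurable]: "g \<in> borel_measurable borel"
    by (rule borel_measurable_continuous_onI[OF cont])
  have [measurable]: "r \<in> borel_measurable borel"
    unfolding r_def by (intro borel_measurable_continuous_onI continuous_intros)
  have [measurable]: "G \<in> borel_measurable borel"
    unfolding G_def by measurable
  have r1: "cmod (r t) = 1" for t
    by (simp add: r_def)
  have Gr: "G (r t * w) = G w" for t w
    by (simp add: G_def norm_mult r1)
  have i': "integrable lborel (\<lambda>w. G w *\<^sub>R g w)"
    using i by (simp add: G_def)
  have it: "integrable lborel (\<lambda>w. G w *\<^sub>R g (r t * w))" for t
  proof -
    have "integrable (distr lborel borel (\<lambda>w. r t * w)) (\<lambda>w. G w *\<^sub>R g w)"
      by (simp add: lborel_distr_rotation r1 i')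
    then show ?thesis
      by (subst (asm) integrable_distr_eq) (auto simp: Gr)
  qed
  have rot: "(\<integral>w. F (r t * w) \<partial>lborel) = (\<integral>w. F w \<partial>lborel)"
    if [measurable]: "F \<in> borel_measurable borel" for t and F :: "complex \<Rightarrow> 'z :: {banach, second_countable_topology}"
    by (subst (2) lborel_distr_rotation[OF r1[of t], symmetric], subst integral_distr) auto
  have I: "(\<integral>w. h t w \<partial>lborel) = indicator {0..1} t *\<^sub>R (\<integral>w. G w *\<^sub>R g w \<partial>lborel)" for t
    using rot[of "\<lambda>w. G w *\<^sub>R g w" t] by (simp add: h_def Gr del: scaleR_scaleR)
  have J: "(\<integral>w. norm (h t w) \<partial>lborel) = indicator {0..1} t *\<^sub>R (\<integral>w. norm (G w *\<^sub>R g w) \<partial>lborel)" for t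
    using rot[of "\<lambda>w. norm (G w *\<^sub>R g w)" t] by (simp add: h_def Gr del: scaleR_scaleR)
  have "integrable (lborel \<Otimes>\<^sub>M lborel) (case_prod h)"
  proof (rule lborel_pair.Fubini_integrable)
    show "case_prod h \<in> borel_measurable (lborel \<Otimes>\<^sub>M lborel)"
      unfolding h_def by measurable
    show "integrable lborel (\<lambda>t. \<integral>w. norm (case_prod h (t, w)) \<partial>lborel)"
      by (auto simp: J intro!: integrable_mult_left)
    show "AE t in lborel. integrable lborel (\<lambda>w. case_prod h (t, w))"
      using it by (simp add: h_def del: scaleR_scaleR)
  qed
  then have F: "(\<integral>w. (\<integral>t. h t w \<partial>lborel) \<partial>lborel) = (\<integral>t. (\<integral>w. h t w \<partial>lborel) \<partial>lborel)"
    by (rule lborel_pair.Fubini_integral)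
  have K: "(\<integral>t. h t w \<partial>lborel) = G w *\<^sub>R g 0" for w
  proof -
    have "continuous_on {0..1} (\<lambda>t. g (r t * w))"
      unfolding r_def by (intro continuous_on_compose2[OF cont] continuous_intros) auto
    then have si: "set_integrable lborel {0..1} (\<lambda>t. g (r t * w))"
      unfolding set_integrable_def by (intro borel_integrable_compact) auto
    have "(LINT t:{0..1}|lborel. g (r t * w)) = g 0"
      using set_borel_integral_eq_integral(2)[OF si] circle_mean_value[OF g, of w]
      by (simp add: r_def integral_unique)
    then have "(\<integral>t. indicator {0..1} t *\<^sub>R g (r t * w) \<partial>lborel) = g 0"
      by (simp add: set_lebesgue_integral_def)
    moreover have "h t w = G w *\<^sub>R (indicator {0..1} t *\<^sub>R g (r t * w))" for t
      by (simp add: h_def)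
    ultimately show ?thesis
      by (simp only: integral_scaleR_right)
  qed
  have hbG: "has_bochner_integral lborel G (pi / \<mu>)"
    using \<mu> nn_integral_gaussian_complex[OF \<mu>]
    by (intro has_bochner_integral_nn_integral) (auto simp: G_def)
  then have "(\<integral>w. G w *\<^sub>R g 0 \<partial>lborel) = (pi / \<mu>) *\<^sub>R g 0"
    by (metis has_bochner_integral_integral_eq has_bochner_integral_scaleR_left)
  with F show ?thesis
    unfolding K I by (simp add: G_def)
qed

lemma bargmann_measurable: "\<phi> \<in> bargmann \<mu> \<Longrightarrow> \<phi> \<in> borel_measurable borel"
  by (auto simp: bargmann_def intro!: borel_measurable_continuous_onI holomorphic_on_imp_continuous_on)

lemma bargmann_iff:
  assumes "\<mu> > 0"
  shows "\<phi> \<in> bargmann \<mu> \<longleftrightarrow> \<phi> holomorphic_on UNIV \<and>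
     (\<integral>\<^sup>+\<xi>. ennreal ((cmod (\<phi> \<xi>))\<^sup>2 * exp (- \<mu> * (cmod \<xi>)\<^sup>2)) \<partial>lborel) < \<infinity>"
  using assms by (auto simp: bargmann_def ennreal_mult_less_top)

text \<open>
  The inequality \<open>p q \<le> p\<^sup>2 + q\<^sup>2\<close> separates \<open>|\<phi>|\<close> from the exponential growth \<open>q\<close> of the kernel; the first
  part is integrable by assumption, and in the second one half of the Gaussian absorbs \<open>q\<^sup>2\<close>.
\<close>

lemma bargmann_kernel_integrable:
  assumes \<mu>: "\<mu> > 0" and \<phi>: "\<phi> \<in> bargmann \<mu>"
  shows "integrable lborel (\<lambda>\<xi>. \<phi> \<xi> * exp (of_real \<mu> * z * cnj \<xi> - of_real (\<mu> * (cmod \<xi>)\<^sup>2)))"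
proof (rule integrableI_bounded)
  note [measurable] = bargmann_measurable[OF \<phi>]
  have [measurable]: "(\<lambda>\<xi>. exp (of_real \<mu> * z * cnj \<xi> - of_real (\<mu> * (cmod \<xi>)\<^sup>2))) \<in> borel_measurable borel"
    by (intro borel_measurable_continuous_onI continuous_intros)
  show "(\<lambda>\<xi>. \<phi> \<xi> * exp (of_real \<mu> * z * cnj \<xi> - of_real (\<mu> * (cmod \<xi>)\<^sup>2))) \<in> borel_measurable lborel"
    by measurable
  define C where "C = exp (2 * \<mu> * (cmod z)\<^sup>2)"
  have bound: "cmod (\<phi> \<xi> * exp (of_real \<mu> * z * cnj \<xi> - of_real (\<mu> * (cmod \<xi>)\<^sup>2)))
      \<le> (cmod (\<phi> \<xi>))\<^sup>2 * exp (- \<mu> * (cmod \<xi>)\<^sup>2) + C * exp (- (\<mu> / 2) * (cmod \<xi>)\<^sup>2)" for \<xi>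
  proof -
    define p where "p = cmod (\<phi> \<xi>)"
    define q where "q = exp (\<mu> * (cmod z * cmod \<xi>))"
    have "Re (z * cnj \<xi>) \<le> cmod z * cmod \<xi>"
      using complex_Re_le_cmod[of "z * cnj \<xi>"] by (simp add: norm_mult)
    then have "exp (\<mu> * Re (z * cnj \<xi>)) \<le> q"
      using \<mu> by (simp add: q_def)
    moreover have "cmod (\<phi> \<xi> * exp (of_real \<mu> * z * cnj \<xi> - of_real (\<mu> * (cmod \<xi>)\<^sup>2)))
      = p * exp (\<mu> * Re (z * cnj \<xi>)) * exp (- \<mu> * (cmod \<xi>)\<^sup>2)"
      by (simp add: norm_mult p_def mult.assoc exp_add[symmetric] algebra_simps)
    ultimately have le: "cmod (\<phi> \<xi> * exp (of_real \<mu> * z * cnj \<xi> - of_real (\<mu> * (cmod \<xi>)\<^sup>2)))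
      \<le> p * q * exp (- \<mu> * (cmod \<xi>)\<^sup>2)"
      by (auto simp only: p_def norm_ge_zero exp_ge_zero intro!: mult_right_mono mult_left_mono)
    have pq: "p * q \<le> p\<^sup>2 + q\<^sup>2"
    proof -
      have "2 * (p * q) \<le> p\<^sup>2 + q\<^sup>2" "0 \<le> p * q"
        using sum_squares_bound[of p q] by (auto simp: p_def q_def mult.assoc)
      then show ?thesis by linarith
    qed
    have qC: "q\<^sup>2 * exp (- \<mu> * (cmod \<xi>)\<^sup>2) \<le> C * exp (- (\<mu> / 2) * (cmod \<xi>)\<^sup>2)"
    proof -
      \<comment> \<open>the difference of the two exponents is this square\<close>
      have "0 \<le> \<mu> / 2 * (2 * cmod z - cmod \<xi>)\<^sup>2"
        using \<mu> by simp
      then have "2 * (\<mu> * (cmod z * cmod \<xi>)) + - \<mu> * (cmod \<xi>)\<^sup>2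
        \<le> 2 * \<mu> * (cmod z)\<^sup>2 + - (\<mu> / 2) * (cmod \<xi>)\<^sup>2"
        by (simp add: power2_eq_square algebra_simps)
      then show ?thesis
        unfolding q_def C_def exp_double[symmetric] exp_add[symmetric] by (simp only: exp_le_cancel_iff)
    qed
    have "p * q * exp (- \<mu> * (cmod \<xi>)\<^sup>2) \<le> (p\<^sup>2 + q\<^sup>2) * exp (- \<mu> * (cmod \<xi>)\<^sup>2)"
      using pq by (rule mult_right_mono) simp
    also have "\<dots> \<le> p\<^sup>2 * exp (- \<mu> * (cmod \<xi>)\<^sup>2) + C * exp (- (\<mu> / 2) * (cmod \<xi>)\<^sup>2)"
      using qC by (simp add: distrib_right)
    finally show ?thesis
      using le unfolding p_def by linarith
  qed
  have "(\<integral>\<^sup>+\<xi>. ennreal (cmod (\<phi> \<xi> * exp (of_real \<mu> * z * cnj \<xi> - of_real (\<mu> * (cmod \<xi>)\<^sup>2)))) \<partial>lborel)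
    \<le> (\<integral>\<^sup>+\<xi>. ennreal ((cmod (\<phi> \<xi>))\<^sup>2 * exp (- \<mu> * (cmod \<xi>)\<^sup>2))
        + ennreal C * ennreal (exp (- (\<mu> / 2) * (cmod \<xi>)\<^sup>2)) \<partial>lborel)"
    using bound by (intro nn_integral_mono)
      (simp add: ennreal_mult[symmetric] ennreal_plus[symmetric] C_def ennreal_leI del: ennreal_plus)
  also have "\<dots> = (\<integral>\<^sup>+\<xi>. ennreal ((cmod (\<phi> \<xi>))\<^sup>2 * exp (- \<mu> * (cmod \<xi>)\<^sup>2)) \<partial>lborel)
      + ennreal C * ennreal (pi / (\<mu> / 2))"
    using \<mu> by (subst nn_integral_add, measurable, subst nn_integral_cmult, measurable,
      subst nn_integral_gaussian_complex) auto
  also have "\<dots> < \<infinity>"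
    using \<phi> \<mu> by (simp add: bargmann_iff ennreal_mult_less_top)
  finally show "(\<integral>\<^sup>+\<xi>. ennreal (cmod (\<phi> \<xi> * exp (of_real \<mu> * z * cnj \<xi> - of_real (\<mu> * (cmod \<xi>)\<^sup>2)))) \<partial>lborel) < \<infinity>" .
qed

text \<open>
  With \<open>\<xi> = z + w\<close> the exponent \<open>\<mu> z cnj \<xi> - \<mu> |\<xi>|\<^sup>2\<close> becomes \<open>- \<mu> |w|\<^sup>2 - \<mu> cnj z w\<close>: the antiholomorphic terms
  cancel, and what remains besides the Gaussian weight is entire in \<open>w\<close>.
\<close>

lemma bargmann_reproducing:
  assumes \<mu>: "\<mu> > 0" and \<phi>: "\<phi> \<in> bargmann \<mu>"
  shows "(\<integral>\<xi>. \<phi> \<xi> * exp (of_real \<mu> * z * cnj \<xi> - of_real (\<mu> * (cmod \<xi>)\<^sup>2)) \<partial>lborel) = (pi / \<mu>) *\<^sub>R \<phi> z"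
proof -
  note [measurable] = bargmann_measurable[OF \<phi>]
  define K where "K \<xi> = \<phi> \<xi> * exp (of_real \<mu> * z * cnj \<xi> - of_real (\<mu> * (cmod \<xi>)\<^sup>2))" for \<xi>
  define g where "g w = \<phi> (z + w) * exp (- of_real \<mu> * cnj z * w)" for w
  have [measurable]: "(\<lambda>\<xi>. exp (of_real \<mu> * z * cnj \<xi> - of_real (\<mu> * (cmod \<xi>)\<^sup>2))) \<in> borel_measurable borel"
    by (intro borel_measurable_continuous_onI continuous_intros)
  have [measurable]: "K \<in> borel_measurable borel"
    unfolding K_def by measurable
  have K: "K (z + w) = exp (- \<mu> * (cmod w)\<^sup>2) *\<^sub>R g w" for w
  proof -
    have "of_real \<mu> * z * cnj (z + w) - of_real (\<mu> * (cmod (z + w))\<^sup>2)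
      = of_real (- \<mu> * (cmod w)\<^sup>2) + (- of_real \<mu> * cnj z * w)"
      by (simp add: complex_norm_square[unfolded of_real_power] algebra_simps)
    then show ?thesis
      unfolding K_def g_def exp_add exp_of_real scaleR_conv_of_real by (simp only: exp_add exp_of_real mult_ac)
  qed
  have "\<phi> holomorphic_on UNIV"
    using \<phi> by (simp add: bargmann_def)
  then have "(\<lambda>w. \<phi> (z + w)) holomorphic_on UNIV"
    by (rule holomorphic_on_compose_gen[where g=\<phi>, unfolded o_def, rotated]) (auto intro!: holomorphic_intros)
  then have g: "g holomorphic_on UNIV"
    unfolding g_def by (auto intro!: holomorphic_intros)
  have "integrable (distr lborel borel ((+) z)) K"
    using bargmann_kernel_integrable[OF assms] by (simp add: lborel_distr_plus K_def[abs_def])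
  then have i: "integrable lborel (\<lambda>w. K (z + w))"
    by (subst (asm) integrable_distr_eq) auto
  have "(\<integral>\<xi>. K \<xi> \<partial>lborel) = (\<integral>w. K (z + w) \<partial>lborel)"
    by (subst lborel_distr_plus[of z, symmetric], subst integral_distr) auto
  also have "\<dots> = (pi / \<mu>) *\<^sub>R g 0"
    using i unfolding K by (rule gaussian_mean_value[OF \<mu> g])
  finally show ?thesis
    by (simp add: K_def g_def)
qed

text \<open>
  A single term of the exponential series gives \<open>x\<^sup>n \<le> n! e\<^sup>x\<close>. With \<open>x = \<mu> |\<xi>|\<^sup>2 / 2\<close> this bounds the
  integrand by a Gaussian of half the rate.
\<close>

lemma power_in_bargmann:
  assumes \<mu>: "\<mu> > 0"
  shows "(\<lambda>\<xi>. \<xi> ^ n) \<in> bargmann \<mu>"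
proof -
  define C where "C = fact n * (2 / \<mu>) ^ n"
  have bound: "(cmod (\<xi> ^ n))\<^sup>2 * exp (- \<mu> * (cmod \<xi>)\<^sup>2) \<le> C * exp (- (\<mu> / 2) * (cmod \<xi>)\<^sup>2)" for \<xi>
  proof -
    define x where "x = \<mu> / 2 * (cmod \<xi>)\<^sup>2"
    have "x \<ge> 0" using \<mu> by (simp add: x_def)
    then have "x ^ n / fact n \<le> exp x"
      using sum_le_suminf[OF summable_exp_generic[of x], of "{n}"]
      by (simp add: exp_def divide_inverse_commute)
    then have "x ^ n \<le> fact n * exp x"
      by (simp add: field_simps)
    then have "(2 / \<mu>) ^ n * x ^ n \<le> (2 / \<mu>) ^ n * (fact n * exp x)"
      using \<mu> by (intro mult_left_mono) auto
    moreover have "(2 / \<mu>) ^ n * x ^ n = (cmod (\<xi> ^ n))\<^sup>2"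
      using \<mu> by (simp add: x_def power_mult_distrib[symmetric] norm_power power_mult[symmetric] mult.commute)
    ultimately have "(cmod (\<xi> ^ n))\<^sup>2 * exp (- \<mu> * (cmod \<xi>)\<^sup>2) \<le> C * exp x * exp (- \<mu> * (cmod \<xi>)\<^sup>2)"
      by (intro mult_right_mono) (auto simp: C_def mult_ac)
    also have "\<dots> = C * exp (- (\<mu> / 2) * (cmod \<xi>)\<^sup>2)"
      by (simp add: x_def mult.assoc exp_add[symmetric])
    finally show ?thesis .
  qed
  have C: "C \<ge> 0" using \<mu> by (simp add: C_def)
  have "(\<integral>\<^sup>+\<xi>. ennreal ((cmod (\<xi> ^ n))\<^sup>2 * exp (- \<mu> * (cmod \<xi>)\<^sup>2)) \<partial>lborel)
    \<le> (\<integral>\<^sup>+\<xi>. ennreal C * ennreal (exp (- (\<mu> / 2) * (cmod \<xi>)\<^sup>2)) \<partial>lborel)"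
    using bound C by (intro nn_integral_mono) (simp add: ennreal_mult[symmetric] ennreal_leI)
  also have "\<dots> = ennreal C * ennreal (pi / (\<mu> / 2))"
    using \<mu> by (subst nn_integral_cmult, measurable, subst nn_integral_gaussian_complex) auto
  also have "\<dots> < \<infinity>"
    by (simp add: ennreal_mult_less_top)
  finally show ?thesis
    using \<mu> by (auto simp: bargmann_iff intro!: holomorphic_intros)
qed

section \<open>The norm in idempotent coordinates\<close>

lemma borel_measurable_bc_components [measurable]:
  "bc_alpha \<in> borel_measurable borel" "bc_beta \<in> borel_measurable borel"
  unfolding bc_alpha_def[abs_def] bc_beta_def[abs_def]
  by (intro borel_measurable_continuous_onI continuous_intros)+

text \<open>
  For fixed \<open>z\<^sub>2\<close>, the variable \<open>\<alpha> = z\<^sub>1 - i z\<^sub>2\<close> is a translate of \<open>z\<^sub>1\<close>; for fixed \<open>\<alpha>\<close>, the variable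
  \<open>\<beta> = \<alpha> + 2 i z\<^sub>2\<close> is an affine image of \<open>z\<^sub>2\<close>, and \<open>|2 i|\<^sup>2 = 4\<close> is the Jacobian.
\<close>

lemma nn_integral_idempotent_coordinates:
  fixes h :: "complex \<Rightarrow> complex \<Rightarrow> ennreal"
  assumes [measurable]: "case_prod h \<in> borel_measurable (borel \<Otimes>\<^sub>M borel)"
  shows "4 * (\<integral>\<^sup>+Z. h (bc_alpha Z) (bc_beta Z) \<partial>lborel) = (\<integral>\<^sup>+a. \<integral>\<^sup>+b. h a b \<partial>lborel \<partial>lborel)"
proof -
  have [measurable]: "(\<lambda>Z. h (bc_alpha Z) (bc_beta Z)) \<in> borel_measurable (lborel \<Otimes>\<^sub>M lborel)"
    unfolding bc_alpha_def bc_beta_def by measurable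
  have 1: "(\<integral>\<^sup>+z1. h (z1 - \<i> * z2) (z1 + \<i> * z2) \<partial>lborel) = (\<integral>\<^sup>+a. h a (a + 2 * \<i> * z2) \<partial>lborel)" for z2
    by (subst nn_integral_complex_affine[where c=1 and t="\<i> * z2"]) (auto simp: algebra_simps)
  have 2: "(\<integral>\<^sup>+b. h a b \<partial>lborel) = 4 * (\<integral>\<^sup>+z2. h a (a + 2 * \<i> * z2) \<partial>lborel)" for a
    by (subst nn_integral_complex_affine[where c="2 * \<i>" and t=a]) (auto simp: norm_mult)
  have "(\<integral>\<^sup>+Z. h (bc_alpha Z) (bc_beta Z) \<partial>lborel)
      = (\<integral>\<^sup>+z2. \<integral>\<^sup>+z1. h (bc_alpha (z1, z2)) (bc_beta (z1, z2)) \<partial>lborel \<partial>lborel)"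
    by (subst lborel_prod[symmetric], rule lborel_pair.nn_integral_snd[symmetric]) measurable
  also have "\<dots> = (\<integral>\<^sup>+z2. \<integral>\<^sup>+a. h a (a + 2 * \<i> * z2) \<partial>lborel \<partial>lborel)"
    by (simp add: bc_alpha_def bc_beta_def 1)
  also have "\<dots> = (\<integral>\<^sup>+a. \<integral>\<^sup>+z2. h a (a + 2 * \<i> * z2) \<partial>lborel \<partial>lborel)"
    by (rule lborel_pair.Fubini') measurable
  finally show ?thesis
    unfolding 2 by (subst nn_integral_cmult) auto
qed

text \<open>
  The factor \<open>2 \<pi> / \<nu>\<close> is the Gaussian integral over the coordinate on which \<open>u\<close> does not depend.
\<close>

lemma nn_integral_gaussian_idempotent:
  assumes \<nu>: "\<nu> > 0" and [measurable]: "u \<in> borel_measurable borel"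
  shows "4 * (\<integral>\<^sup>+Z. ennreal (exp (- \<nu> * (norm Z)\<^sup>2) * (cmod (u (bc_alpha Z)))\<^sup>2) \<partial>lborel)
      = ennreal (2 * pi / \<nu>) * (\<integral>\<^sup>+\<xi>. ennreal ((cmod (u \<xi>))\<^sup>2 * exp (- (\<nu> / 2) * (cmod \<xi>)\<^sup>2)) \<partial>lborel)"
    and "4 * (\<integral>\<^sup>+Z. ennreal (exp (- \<nu> * (norm Z)\<^sup>2) * (cmod (u (bc_beta Z)))\<^sup>2) \<partial>lborel)
      = ennreal (2 * pi / \<nu>) * (\<integral>\<^sup>+\<xi>. ennreal ((cmod (u \<xi>))\<^sup>2 * exp (- (\<nu> / 2) * (cmod \<xi>)\<^sup>2)) \<partial>lborel)"
proof -
  define E where "E \<xi> = ennreal (exp (- (\<nu> / 2) * (cmod \<xi>)\<^sup>2))" for \<xi>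
  define U where "U \<xi> = ennreal ((cmod (u \<xi>))\<^sup>2 * exp (- (\<nu> / 2) * (cmod \<xi>)\<^sup>2))" for \<xi>
  have [measurable]: "E \<in> borel_measurable borel" "U \<in> borel_measurable borel"
    unfolding E_def U_def by measurable
  have E: "(\<integral>\<^sup>+\<xi>. E \<xi> \<partial>lborel) = ennreal (2 * pi / \<nu>)"
    unfolding E_def using \<nu> by (subst nn_integral_gaussian_complex) (auto simp: mult.commute)
  have w: "exp (- \<nu> * (norm Z)\<^sup>2) = exp (- (\<nu> / 2) * (cmod (bc_alpha Z))\<^sup>2) * exp (- (\<nu> / 2) * (cmod (bc_beta Z))\<^sup>2)"
    for Z
    by (simp add: bc_norm_sq_alpha_beta exp_add[symmetric] field_simps)
  have "ennreal (exp (- \<nu> * (norm Z)\<^sup>2) * (cmod (u (bc_alpha Z)))\<^sup>2) = U (bc_alpha Z) * E (bc_beta Z)" for Z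
    unfolding w by (simp add: U_def E_def ennreal_mult[symmetric] mult_ac)
  moreover have "4 * (\<integral>\<^sup>+Z. U (bc_alpha Z) * E (bc_beta Z) \<partial>lborel) = ennreal (2 * pi / \<nu>) * (\<integral>\<^sup>+\<xi>. U \<xi> \<partial>lborel)"
    by (subst nn_integral_idempotent_coordinates)
      (auto simp: nn_integral_cmult nn_integral_multc E mult.commute)
  ultimately show "4 * (\<integral>\<^sup>+Z. ennreal (exp (- \<nu> * (norm Z)\<^sup>2) * (cmod (u (bc_alpha Z)))\<^sup>2) \<partial>lborel)
      = ennreal (2 * pi / \<nu>) * (\<integral>\<^sup>+\<xi>. ennreal ((cmod (u \<xi>))\<^sup>2 * exp (- (\<nu> / 2) * (cmod \<xi>)\<^sup>2)) \<partial>lborel)"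
    by (simp add: U_def)
  have "ennreal (exp (- \<nu> * (norm Z)\<^sup>2) * (cmod (u (bc_beta Z)))\<^sup>2) = E (bc_alpha Z) * U (bc_beta Z)" for Z
    unfolding w by (simp add: U_def E_def ennreal_mult[symmetric] mult_ac)
  moreover have "4 * (\<integral>\<^sup>+Z. E (bc_alpha Z) * U (bc_beta Z) \<partial>lborel) = ennreal (2 * pi / \<nu>) * (\<integral>\<^sup>+\<xi>. U \<xi> \<partial>lborel)"
    by (subst nn_integral_idempotent_coordinates)
      (auto simp: nn_integral_cmult nn_integral_multc E mult.commute)
  ultimately show "4 * (\<integral>\<^sup>+Z. ennreal (exp (- \<nu> * (norm Z)\<^sup>2) * (cmod (u (bc_beta Z)))\<^sup>2) \<partial>lborel)
      = ennreal (2 * pi / \<nu>) * (\<integral>\<^sup>+\<xi>. ennreal ((cmod (u \<xi>))\<^sup>2 * exp (- (\<nu> / 2) * (cmod \<xi>)\<^sup>2)) \<partial>lborel)"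
    by (simp add: U_def)
qed

lemma bc_hilbert_idem_iff:
  assumes \<nu>: "\<nu> > 0" and \<phi>: "\<phi> holomorphic_on UNIV" and \<psi>: "\<psi> holomorphic_on UNIV"
  shows "(\<lambda>Z. bc_idem (\<phi> (bc_alpha Z)) (\<psi> (bc_beta Z))) \<in> bc_hilbert \<nu>
    \<longleftrightarrow> \<phi> \<in> bargmann (\<nu> / 2) \<and> \<psi> \<in> bargmann (\<nu> / 2)"
proof -
  have [measurable]: "\<phi> \<in> borel_measurable borel" "\<psi> \<in> borel_measurable borel"
    using \<phi> \<psi> by (auto intro!: borel_measurable_continuous_onI holomorphic_on_imp_continuous_on)
  let ?f = "\<lambda>Z. bc_idem (\<phi> (bc_alpha Z)) (\<psi> (bc_beta Z))"
  let ?N = "\<lambda>u. \<integral>\<^sup>+\<xi>. ennreal ((cmod (u \<xi>))\<^sup>2 * exp (- (\<nu> / 2) * (cmod \<xi>)\<^sup>2)) \<partial>lborel"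
  let ?A = "\<integral>\<^sup>+Z. ennreal (exp (- \<nu> * (norm Z)\<^sup>2) * (cmod (\<phi> (bc_alpha Z)))\<^sup>2) \<partial>lborel"
  let ?B = "\<integral>\<^sup>+Z. ennreal (exp (- \<nu> * (norm Z)\<^sup>2) * (cmod (\<psi> (bc_beta Z)))\<^sup>2) \<partial>lborel"
  have m: "?f \<in> borel_measurable borel"
    unfolding bc_idem_eq by measurable
  have N: "bc_norm2 \<nu> ?f = (ennreal ((\<nu> / pi)\<^sup>2) * ?A + ennreal ((\<nu> / pi)\<^sup>2) * ?B) / 2"
    by (simp add: bc_norm2_def Let_def bc_alpha_inner_integrand bc_beta_inner_integrand del: of_real_mult)
  have fin: "c * X < \<infinity> \<longleftrightarrow> X < \<infinity>" if "0 < c" "c < \<infinity>" for c X :: ennreal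
    using that by (auto simp: ennreal_mult_less_top)
  have "?A < \<infinity> \<longleftrightarrow> ?N \<phi> < \<infinity>"
    using fin[of 4 ?A] fin[of "ennreal (2 * pi / \<nu>)" "?N \<phi>"] \<nu>
      nn_integral_gaussian_idempotent(1)[OF \<nu>, of \<phi>] by simp
  moreover have "?B < \<infinity> \<longleftrightarrow> ?N \<psi> < \<infinity>"
    using fin[of 4 ?B] fin[of "ennreal (2 * pi / \<nu>)" "?N \<psi>"] \<nu>
      nn_integral_gaussian_idempotent(2)[OF \<nu>, of \<psi>] by simp
  ultimately show ?thesis
    using \<nu> \<phi> \<psi> m unfolding bc_hilbert_def mem_Collect_eq N
    by (auto simp: bc_hilbert_def bargmann_iff ennreal_mult_less_top ennreal_divide_eq_top_iff less_top[symmetric] ennreal_mult_eq_top_iff)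
qed

section \<open>Bicomplex holomorphic functions split\<close>

lemma constant_if_locally_constant:
  fixes f :: "complex \<Rightarrow> 'a"
  assumes "\<And>z. \<exists>d>0. \<forall>k. k \<noteq> 0 \<longrightarrow> cmod k < d \<longrightarrow> f (z + k) = f z"
  shows "f z = f w"
proof (rule connected_local_const[of UNIV z w f])
  show "\<forall>a\<in>UNIV. eventually (\<lambda>b. f a = f b) (at a within UNIV)"
  proof
    fix a
    obtain d where d: "d > 0" "\<And>k. k \<noteq> 0 \<Longrightarrow> cmod k < d \<Longrightarrow> f (a + k) = f a"
      using assms by blast
    have "f a = f b" if "b \<noteq> a" "dist b a < d" for b
      using d(2)[of "b - a"] that by (simp add: dist_norm)
    then show "eventually (\<lambda>b. f a = f b) (at a within UNIV)"
      using d(1) by (auto simp: eventually_at)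
  qed
qed auto

lemma filterlim_diagonal:
  "filterlim (\<lambda>h::complex. (h, h)) (at 0 within {(h, k). h \<noteq> 0 \<and> k \<noteq> 0}) (at 0)"
proof -
  have "((\<lambda>h::complex. (h, h)) \<longlongrightarrow> (0, 0)) (at 0)"
    by (intro tendsto_intros)
  then show ?thesis
    by (auto simp: filterlim_at eventually_at_filter zero_prod_def)
qed

text \<open>
  Here \<open>A\<close> is the \<open>e\<^sub>+\<close> component of a bicomplex function, and its increment in both variables is divided by
  the increment \<open>h\<close> of the first alone. Convergence gives \<open>|A (a + h, b + k) - A (a, b)| \<le> C |h|\<close> for all small
  nonzero \<open>h\<close> and \<open>k\<close>. Letting \<open>h\<close> tend to \<open>0\<close> with \<open>k\<close> fixed would finish, but the value at \<open>(a, b + k)\<close> is only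
  accessible through increments nonzero in both variables. So that point is approached diagonally, along
  \<open>(a + h, b + k + h)\<close>, where the quotient centred at \<open>(a, b + k)\<close> gives convergence and the bound above still
  applies. Hence \<open>A a\<close> is locally constant.
\<close>

lemma independent_of_second_variable:
  fixes A :: "complex \<Rightarrow> complex \<Rightarrow> complex"
  assumes lim: "\<And>a b. \<exists>L. ((\<lambda>(h, k). (A (a + h) (b + k) - A a b) / h) \<longlongrightarrow> L) (at 0 within {(h, k). h \<noteq> 0 \<and> k \<noteq> 0})"
  shows "A a b = A a b'"
proof (rule constant_if_locally_constant[where f="A a"])
  fix b
  obtain L where L: "((\<lambda>(h, k). (A (a + h) (b + k) - A a b) / h) \<longlongrightarrow> L) (at 0 within {(h, k). h \<noteq> 0 \<and> k \<noteq> 0})"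
    using lim by blast
  define C where "C = cmod L + 1"
  have "eventually (\<lambda>p. dist ((\<lambda>(h, k). (A (a + h) (b + k) - A a b) / h) p) L < 1) (at 0 within {(h, k). h \<noteq> 0 \<and> k \<noteq> 0})"
    using L by (rule tendstoD) simp
  then obtain d where d0: "d > 0" and d1: "\<And>p. p \<in> {(h, k). h \<noteq> 0 \<and> k \<noteq> 0} \<Longrightarrow> p \<noteq> 0 \<and> dist p 0 < d \<Longrightarrow>
      dist ((\<lambda>(h, k). (A (a + h) (b + k) - A a b) / h) p) L < 1"
    unfolding eventually_at by blast
  have d2: "dist ((A (a + h) (b + k) - A a b) / h) L < 1" if "h \<noteq> 0" "k \<noteq> 0" "norm (h, k) < d" for h k
    using d1[of "(h, k)"] that by (simp add: zero_prod_def dist_norm)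
  have bound: "cmod (A (a + h) (b + k) - A a b) \<le> C * cmod h"
    if "h \<noteq> 0" "k \<noteq> 0" "norm (h, k) < d" for h k
  proof -
    have "cmod ((A (a + h) (b + k) - A a b) / h) \<le> C"
      using d2[OF that] norm_triangle_sub[of "(A (a + h) (b + k) - A a b) / h" L]
      by (simp add: C_def dist_norm)
    then show ?thesis
      using that by (simp add: norm_divide divide_le_eq)
  qed
  show "\<exists>d>0. \<forall>k. k \<noteq> 0 \<longrightarrow> cmod k < d \<longrightarrow> A a (b + k) = A a b"
  proof (intro exI[of _ d] conjI allI impI d0)
    fix k :: complex assume k: "k \<noteq> 0" "cmod k < d"
    obtain M where M: "((\<lambda>(h, l). (A (a + h) (b + k + l) - A a (b + k)) / h) \<longlongrightarrow> M) (at 0 within {(h, k). h \<noteq> 0 \<and> k \<noteq> 0})"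
      using lim by blast
    from filterlim_compose[OF M filterlim_diagonal]
    have "((\<lambda>h. (A (a + h) (b + k + h) - A a (b + k)) / h) \<longlongrightarrow> M) (at 0)"
      by simp
    from tendsto_mult[OF this tendsto_ident_at]
    have "((\<lambda>h. (A (a + h) (b + k + h) - A a (b + k)) / h * h) \<longlongrightarrow> M * 0) (at 0)" .
    moreover have "eventually (\<lambda>h. (A (a + h) (b + k + h) - A a (b + k)) / h * h = A (a + h) (b + k + h) - A a (b + k)) (at 0)"
      by (auto simp: eventually_at_filter)
    ultimately have "((\<lambda>h. A (a + h) (b + k + h) - A a (b + k)) \<longlongrightarrow> 0) (at 0)"
      by (simp cong: filterlim_cong add: Lim_transform_eventually)
    then have "((\<lambda>h. A (a + h) (b + k + h)) \<longlongrightarrow> A a (b + k)) (at 0)"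
      by (simp add: LIM_zero_iff)
    then have 1: "((\<lambda>h. cmod (A (a + h) (b + k + h) - A a b)) \<longlongrightarrow> cmod (A a (b + k) - A a b)) (at 0)"
      by (intro tendsto_intros)
    have 2: "((\<lambda>h. C * cmod h) \<longlongrightarrow> 0) (at 0)"
      by (auto intro!: tendsto_eq_intros)
    have "((\<lambda>h. norm (h, k + h)) \<longlongrightarrow> norm (0 :: complex, k + 0)) (at 0)"
      by (intro tendsto_intros)
    then have "eventually (\<lambda>h. norm (h, k + h) < d) (at 0)"
      using k by (intro order_tendstoD(2)) (auto simp: norm_prod_def)
    moreover have "((\<lambda>h. k + h) \<longlongrightarrow> k + 0) (at 0)"
      by (intro tendsto_intros)
    then have "eventually (\<lambda>h. k + h \<noteq> 0) (at 0)"
      using k by (intro tendsto_imp_eventually_ne) auto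
    moreover have "eventually (\<lambda>h::complex. h \<noteq> 0) (at 0)"
      by (auto simp: eventually_at_filter)
    ultimately have "eventually (\<lambda>h. cmod (A (a + h) (b + k + h) - A a b) \<le> C * cmod h) (at 0)"
    proof eventually_elim
      case (elim h)
      then show ?case
        using bound[of h "k + h"] by (simp add: add.assoc)
    qed
    then have "cmod (A a (b + k) - A a b) \<le> 0"
      using tendsto_le[OF _ 2 1] by simp
    then show "A a (b + k) = A a b"
      by simp
  qed
qed

lemma bc_idem_continuous:
  assumes "(a \<longlongrightarrow> x) F" "(b \<longlongrightarrow> y) F"
  shows "((\<lambda>t. bc_idem (a t) (b t)) \<longlongrightarrow> bc_idem x y) F"
  unfolding bc_idem_eq using assms by (auto intro!: tendsto_intros)

lemma bc_alpha_linear: "bc_alpha (Z + W) = bc_alpha Z + bc_alpha W" "bc_alpha (Z - W) = bc_alpha Z - bc_alpha W"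
    "bc_alpha (r *\<^sub>R Z) = r *\<^sub>R bc_alpha Z" "bc_alpha (bc_of_complex z) = z"
  and bc_beta_linear: "bc_beta (Z + W) = bc_beta Z + bc_beta W" "bc_beta (Z - W) = bc_beta Z - bc_beta W"
    "bc_beta (r *\<^sub>R Z) = r *\<^sub>R bc_beta Z" "bc_beta (bc_of_complex z) = z"
  by (auto simp: bc_alpha_def bc_beta_def bc_of_complex_def algebra_simps)

text \<open>
  The null cone is exactly where a component vanishes, so outside it both components of a small
  increment are small and nonzero. This lemma carries limits from the plane to the bicomplex numbers, and
  \<open>filterlim_bc_idem\<close> carries them back.
\<close>

lemma filterlim_bc_components:
  "filterlim bc_alpha (at 0) (at 0 within - bc_null_cone)"
  "filterlim bc_beta (at 0) (at 0 within - bc_null_cone)"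
proof -
  have 1: "(bc_alpha \<longlongrightarrow> bc_alpha 0) (at 0 within - bc_null_cone)" "(bc_beta \<longlongrightarrow> bc_beta 0) (at 0 within - bc_null_cone)"
    unfolding bc_alpha_def bc_beta_def by (intro tendsto_intros)+
  have "bc_alpha 0 = 0" "bc_beta 0 = 0"
    by (auto simp: bc_alpha_def bc_beta_def)
  with 1 show "filterlim bc_alpha (at 0) (at 0 within - bc_null_cone)"
    "filterlim bc_beta (at 0) (at 0 within - bc_null_cone)"
    by (auto simp: filterlim_at eventually_at_filter bc_null_cone_iff)
qed

lemma filterlim_bc_idem:
  "filterlim (\<lambda>(h, k). bc_idem h k) (at 0 within - bc_null_cone) (at 0 within {(h, k). h \<noteq> 0 \<and> k \<noteq> 0})"
proof -
  have "((\<lambda>p. bc_idem (fst p) (snd p)) \<longlongrightarrow> bc_idem (fst (0 :: bicomplex)) (snd (0 :: bicomplex))) (at 0 within {(h, k). h \<noteq> 0 \<and> k \<noteq> (0::complex)})"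
    by (rule bc_idem_continuous[OF tendsto_fst[OF tendsto_ident_at] tendsto_snd[OF tendsto_ident_at]])
  moreover have "bc_idem 0 0 = 0"
    by (simp add: bc_idem_eq zero_prod_def)
  moreover have "bc_idem h k \<noteq> 0" if "h \<noteq> 0" for h k
    using that by (metis bc_alpha_idem \<open>bc_idem 0 0 = 0\<close>)
  ultimately show ?thesis
    by (auto simp: filterlim_at eventually_at_filter bc_null_cone_iff case_prod_unfold)
qed

lemma bc_holomorphic_idem:
  assumes \<phi>: "\<phi> holomorphic_on UNIV" and \<psi>: "\<psi> holomorphic_on UNIV"
  shows "bc_holomorphic (\<lambda>Z. bc_idem (\<phi> (bc_alpha Z)) (\<psi> (bc_beta Z)))"
  unfolding bc_holomorphic_def
proof
  fix Z0
  have "\<exists>D. (u has_field_derivative D) (at z)" if "u holomorphic_on UNIV" for u :: "complex \<Rightarrow> complex" and z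
    using that by (auto simp: holomorphic_on_def field_differentiable_def)
  then obtain p q where "(\<phi> has_field_derivative p) (at (bc_alpha Z0))" "(\<psi> has_field_derivative q) (at (bc_beta Z0))"
    using \<phi> \<psi> by meson
  then have "((\<lambda>h. (\<phi> (bc_alpha Z0 + h) - \<phi> (bc_alpha Z0)) / h) \<longlongrightarrow> p) (at 0)"
      "((\<lambda>h. (\<psi> (bc_beta Z0 + h) - \<psi> (bc_beta Z0)) / h) \<longlongrightarrow> q) (at 0)"
    by (auto simp: DERIV_def)
  then have "((\<lambda>H. bc_idem ((\<phi> (bc_alpha Z0 + bc_alpha H) - \<phi> (bc_alpha Z0)) / bc_alpha H)
      ((\<psi> (bc_beta Z0 + bc_beta H) - \<psi> (bc_beta Z0)) / bc_beta H)) \<longlongrightarrow> bc_idem p q) (at 0 within - bc_null_cone)"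
    by (intro bc_idem_continuous filterlim_compose[OF _ filterlim_bc_components(1)]
        filterlim_compose[OF _ filterlim_bc_components(2)])
  then show "\<exists>L. ((\<lambda>H. bc_divide (bc_idem (\<phi> (bc_alpha (Z0 + H))) (\<psi> (bc_beta (Z0 + H)))
      - bc_idem (\<phi> (bc_alpha Z0)) (\<psi> (bc_beta Z0))) H) \<longlongrightarrow> L) (at 0 within - bc_null_cone)"
    unfolding bc_divide_def bc_alpha_linear bc_beta_linear bc_alpha_idem bc_beta_idem by (rule exI)
qed

text \<open>
  Since \<open>A\<close> depends on the first variable only, its bicomplex quotient along the diagonal \<open>h = k\<close> is the
  ordinary difference quotient.
\<close>

lemma entire_if_bicomplex_quotient_converges:
  fixes A :: "complex \<Rightarrow> complex \<Rightarrow> complex"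
  assumes lim: "\<And>a b. \<exists>L. ((\<lambda>(h, k). (A (a + h) (b + k) - A a b) / h) \<longlongrightarrow> L) (at 0 within {(h, k). h \<noteq> 0 \<and> k \<noteq> 0})"
  obtains \<phi> where "\<phi> holomorphic_on UNIV" "\<And>a b. A a b = \<phi> a"
proof
  show eq: "A a b = (\<lambda>a. A a 0) a" for a b
    using independent_of_second_variable[OF lim] by blast
  show "(\<lambda>a. A a 0) holomorphic_on UNIV"
    unfolding holomorphic_on_def field_differentiable_def
  proof
    fix a
    obtain L where L: "((\<lambda>(h, k). (A (a + h) (0 + k) - A a 0) / h) \<longlongrightarrow> L) (at 0 within {(h, k). h \<noteq> 0 \<and> k \<noteq> 0})"
      using lim by blast
    from filterlim_compose[OF L filterlim_diagonal]
    have "((\<lambda>h. (A (a + h) h - A a 0) / h) \<longlongrightarrow> L) (at 0)"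
      by simp
    moreover have "A (a + h) h = A (a + h) 0" for h
      by (rule independent_of_second_variable[OF lim])
    ultimately have "((\<lambda>a. A a 0) has_field_derivative L) (at a)"
      by (simp only: DERIV_def)
    then show "\<exists>D. ((\<lambda>a. A a 0) has_field_derivative D) (at a within UNIV)"
      by blast
  qed
qed

lemma bc_holomorphic_imp_idem:
  assumes f: "bc_holomorphic f"
  obtains \<phi> \<psi> where "\<phi> holomorphic_on UNIV" "\<psi> holomorphic_on UNIV"
    "f = (\<lambda>Z. bc_idem (\<phi> (bc_alpha Z)) (\<psi> (bc_beta Z)))"
proof -
  have lim: "\<exists>L. ((\<lambda>(h, k). bc_divide (f (bc_idem (a + h) (b + k)) - f (bc_idem a b)) (bc_idem h k)) \<longlongrightarrow> L)
      (at 0 within {(h, k). h \<noteq> 0 \<and> k \<noteq> 0})" for a b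
  proof -
    obtain L where "((\<lambda>H. bc_divide (f (bc_idem a b + H) - f (bc_idem a b)) H) \<longlongrightarrow> L) (at 0 within - bc_null_cone)"
      using f unfolding bc_holomorphic_def by blast
    from filterlim_compose[OF this filterlim_bc_idem]
    have "((\<lambda>(h, k). bc_divide (f (bc_idem a b + bc_idem h k) - f (bc_idem a b)) (bc_idem h k)) \<longlongrightarrow> L)
      (at 0 within {(h, k). h \<noteq> 0 \<and> k \<noteq> 0})"
      unfolding case_prod_unfold .
    moreover have "bc_idem a b + bc_idem h k = bc_idem (a + h) (b + k)" for h k
      by (simp add: bc_eq_iff bc_alpha_linear bc_beta_linear)
    ultimately show ?thesis
      by (intro exI[of _ L]) (simp only:)
  qed
  have ct: "((\<lambda>p. bc_alpha (u p)) \<longlongrightarrow> bc_alpha L) F" "((\<lambda>p. bc_beta (u p)) \<longlongrightarrow> bc_beta L) F"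
    if "(u \<longlongrightarrow> L) F" for u L and F :: "'z filter"
    using that unfolding bc_alpha_def bc_beta_def by (auto intro!: tendsto_intros)
  have "\<exists>L. ((\<lambda>(h, k). (bc_alpha (f (bc_idem (a + h) (b + k))) - bc_alpha (f (bc_idem a b))) / h) \<longlongrightarrow> L)
      (at 0 within {(h, k). h \<noteq> 0 \<and> k \<noteq> 0})" for a b
  proof -
    obtain L where "((\<lambda>(h, k). bc_divide (f (bc_idem (a + h) (b + k)) - f (bc_idem a b)) (bc_idem h k)) \<longlongrightarrow> L)
      (at 0 within {(h, k). h \<noteq> 0 \<and> k \<noteq> 0})"
      using lim by blast
    from ct(1)[OF this] show ?thesis
      unfolding case_prod_unfold bc_divide_def bc_alpha_idem bc_alpha_linear by (rule exI)
  qed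
  then obtain \<phi> where \<phi>: "\<phi> holomorphic_on UNIV" "\<And>a b. bc_alpha (f (bc_idem a b)) = \<phi> a"
    by (rule entire_if_bicomplex_quotient_converges[where A="\<lambda>a b. bc_alpha (f (bc_idem a b))"]) (rule that)
  have "\<exists>L. ((\<lambda>(h, k). (bc_beta (f (bc_idem (a + k) (b + h))) - bc_beta (f (bc_idem a b))) / h) \<longlongrightarrow> L)
      (at 0 within {(h, k). h \<noteq> 0 \<and> k \<noteq> 0})" for b a
  proof -
    obtain L where "((\<lambda>(h, k). bc_divide (f (bc_idem (a + h) (b + k)) - f (bc_idem a b)) (bc_idem h k)) \<longlongrightarrow> L)
      (at 0 within {(h, k). h \<noteq> 0 \<and> k \<noteq> 0})"
      using lim by blast
    from ct(2)[OF this]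
    have l: "((\<lambda>(h, k). (bc_beta (f (bc_idem (a + h) (b + k))) - bc_beta (f (bc_idem a b))) / k) \<longlongrightarrow> bc_beta L)
        (at 0 within {(h, k). h \<noteq> 0 \<and> k \<noteq> 0})"
      unfolding case_prod_unfold bc_divide_def bc_beta_idem bc_beta_linear .
    \<comment> \<open>the other component divides by \<open>k\<close>; exchanging the variables brings it to the same form\<close>
    have "((\<lambda>p::bicomplex. (snd p, fst p)) \<longlongrightarrow> 0) (at 0 within {(h, k). h \<noteq> 0 \<and> k \<noteq> 0})"
      by (rule tendsto_eq_rhs[OF tendsto_Pair[OF tendsto_snd[OF tendsto_ident_at] tendsto_fst[OF tendsto_ident_at]]])
        (simp add: zero_prod_def)
    moreover have "eventually (\<lambda>p. p \<in> {(h, k). h \<noteq> 0 \<and> k \<noteq> 0}) (at (0 :: bicomplex) within {(h, k). h \<noteq> 0 \<and> k \<noteq> 0})"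
      by (simp add: eventually_at_filter)
    then have "eventually (\<lambda>p. (snd p, fst p) \<in> {(h, k). h \<noteq> 0 \<and> k \<noteq> 0} \<and> (snd p, fst p) \<noteq> 0)
        (at (0 :: bicomplex) within {(h, k). h \<noteq> 0 \<and> k \<noteq> 0})"
      by (rule eventually_mono) (auto simp: zero_prod_def)
    ultimately have swap: "filterlim (\<lambda>p::bicomplex. (snd p, fst p)) (at 0 within {(h, k). h \<noteq> 0 \<and> k \<noteq> 0})
        (at 0 within {(h, k). h \<noteq> 0 \<and> k \<noteq> 0})"
      unfolding filterlim_at by blast
    show ?thesis
      using filterlim_compose[OF l swap] unfolding case_prod_unfold fst_conv snd_conv by (rule exI)
  qed
  then obtain \<psi> where \<psi>: "\<psi> holomorphic_on UNIV" "\<And>b a. bc_beta (f (bc_idem a b)) = \<psi> b"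
    by (rule entire_if_bicomplex_quotient_converges[where A="\<lambda>b a. bc_beta (f (bc_idem a b))"]) (rule that)
  have "f Z = bc_idem (\<phi> (bc_alpha Z)) (\<psi> (bc_beta Z))" for Z
    using \<phi>(2)[of "bc_alpha Z" "bc_beta Z"] \<psi>(2)[of "bc_alpha Z" "bc_beta Z"]
    by (simp add: bc_eq_iff)
  then show thesis
    by (intro that[OF \<phi>(1) \<psi>(1)] ext)
qed

lemma bc_bargmann_eq:
  assumes "\<nu> > 0"
  shows "bc_bargmann \<nu> = {\<lambda>Z. bc_idem (\<phi> (bc_alpha Z)) (\<psi> (bc_beta Z)) | \<phi> \<psi>.
    \<phi> \<in> bargmann (\<nu> / 2) \<and> \<psi> \<in> bargmann (\<nu> / 2)}" (is "_ = ?R")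
proof (intro equalityI subsetI)
  fix f assume f: "f \<in> bc_bargmann \<nu>"
  then have "bc_holomorphic f"
    by (simp add: bc_bargmann_def)
  then obtain \<phi> \<psi> where *: "\<phi> holomorphic_on UNIV" "\<psi> holomorphic_on UNIV"
    "f = (\<lambda>Z. bc_idem (\<phi> (bc_alpha Z)) (\<psi> (bc_beta Z)))"
    by (rule bc_holomorphic_imp_idem)
  then have "\<phi> \<in> bargmann (\<nu> / 2) \<and> \<psi> \<in> bargmann (\<nu> / 2)"
    using f bc_hilbert_idem_iff[OF assms *(1,2)] by (simp add: bc_bargmann_def)
  with *(3) show "f \<in> ?R"
    by blast
next
  fix f assume "f \<in> ?R"
  then obtain \<phi> \<psi> where *: "\<phi> \<in> bargmann (\<nu> / 2)" "\<psi> \<in> bargmann (\<nu> / 2)"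
    "f = (\<lambda>Z. bc_idem (\<phi> (bc_alpha Z)) (\<psi> (bc_beta Z)))" by blast
  then have h: "\<phi> holomorphic_on UNIV" "\<psi> holomorphic_on UNIV"
    by (auto simp: bargmann_def)
  show "f \<in> bc_bargmann \<nu>"
    using * bc_hilbert_idem_iff[OF assms h] bc_holomorphic_idem[OF h] by (simp add: bc_bargmann_def)
qed

section \<open>The transform\<close>

lemma bc_transform_integrand_idem:
  "bc_transform_integrand \<nu> (\<lambda>\<xi>. bc_idem (\<phi> \<xi>) (\<psi> \<xi>)) Z \<xi> = bc_idem
    (\<phi> \<xi> * exp (of_real (\<nu> / 2) * bc_alpha Z * cnj \<xi> - of_real (\<nu> / 2 * (cmod \<xi>)\<^sup>2)))
    (\<psi> \<xi> * exp (of_real (\<nu> / 2) * bc_beta Z * cnj \<xi> - of_real (\<nu> / 2 * (cmod \<xi>)\<^sup>2)))"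
  by (simp add: bc_eq_iff bc_transform_integrand_def bc_exp_def bc_alpha_linear bc_beta_linear
      scaleR_conv_of_real mult.assoc)

text \<open>
  The classical reproducing property with \<open>\<mu> = \<nu> / 2\<close> in each component; its constant \<open>\<pi> / \<mu> = 2 \<pi> / \<nu>\<close> is
  the inverse of the normalisation of the transform.
\<close>

lemma bc_transform_idem:
  assumes \<nu>: "\<nu> > 0" and \<phi>: "\<phi> \<in> bargmann (\<nu> / 2)" and \<psi>: "\<psi> \<in> bargmann (\<nu> / 2)"
  shows "integrable lborel (bc_transform_integrand \<nu> (\<lambda>\<xi>. bc_idem (\<phi> \<xi>) (\<psi> \<xi>)) Z)" (is ?i)
    and "bc_transform \<nu> (\<lambda>\<xi>. bc_idem (\<phi> \<xi>) (\<psi> \<xi>)) Z = bc_idem (\<phi> (bc_alpha Z)) (\<psi> (bc_beta Z))" (is ?t)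
proof -
  have n2: "\<nu> / 2 > 0" using \<nu> by simp
  have bl: "bounded_linear bc_alpha" "bounded_linear bc_beta"
    unfolding bc_alpha_def[abs_def] bc_beta_def[abs_def]
    by (auto intro!: bounded_linear_intros)
  have dec: "bc_idem x y = (x * (1 / 2), x * (\<i> / 2)) + (y * (1 / 2), y * (- \<i> / 2))" for x y
    by (simp add: bc_idem_eq field_simps)
  have b: "bounded_linear (\<lambda>x::complex. (x * (1 / 2), x * (\<i> / 2)))"
      "bounded_linear (\<lambda>y::complex. (y * (1 / 2), y * (- \<i> / 2)))"
    by (intro bounded_linear_Pair bounded_linear_mult_left)+
  show i: ?i
    using Bochner_Integration.integrable_add[OF
        integrable_bounded_linear[OF b(1) bargmann_kernel_integrable[OF n2 \<phi>, of "bc_alpha Z"]]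
        integrable_bounded_linear[OF b(2) bargmann_kernel_integrable[OF n2 \<psi>, of "bc_beta Z"]]]
    unfolding dec[symmetric] bc_transform_integrand_idem[of \<nu> \<phi> \<psi> Z, symmetric] .
  have c: "(\<nu> / (2 * pi)) *\<^sub>R ((pi / (\<nu> / 2)) *\<^sub>R x) = x" for x :: complex
    using \<nu> by simp
  have "bc_alpha (bc_transform \<nu> (\<lambda>\<xi>. bc_idem (\<phi> \<xi>) (\<psi> \<xi>)) Z) = \<phi> (bc_alpha Z)"
    unfolding bc_transform_def bc_alpha_linear integral_bounded_linear[OF bl(1) i, symmetric]
    unfolding bc_transform_integrand_idem bc_alpha_idem bargmann_reproducing[OF n2 \<phi>] by (rule c)
  moreover have "bc_beta (bc_transform \<nu> (\<lambda>\<xi>. bc_idem (\<phi> \<xi>) (\<psi> \<xi>)) Z) = \<psi> (bc_beta Z)"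
    unfolding bc_transform_def bc_beta_linear integral_bounded_linear[OF bl(2) i, symmetric]
    unfolding bc_transform_integrand_idem bc_beta_idem bargmann_reproducing[OF n2 \<psi>] by (rule c)
  ultimately show ?t
    by (simp add: bc_eq_iff)
qed

lemma bc_of_complex_eq_idem: "bc_of_complex z = bc_idem z z"
  by (simp add: bc_eq_iff bc_alpha_linear bc_beta_linear)

lemma bc_power_eq_idem: "bc_power Z n = bc_idem (bc_alpha Z ^ n) (bc_beta Z ^ n)"
  by (induction n) (simp_all add: bc_of_complex_eq_idem bc_eq_iff)

theorem theorem4p4:
  fixes \<nu> :: real
  assumes "\<nu> > 0"
  shows "(\<forall>F \<in> bargmann_bc (\<nu> / 2). \<forall>Z. integrable lborel (bc_transform_integrand \<nu> F Z))
    \<and> bc_transform \<nu> ` bargmann_bc (\<nu> / 2) = bc_bargmann \<nu>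
    \<and> (\<lambda>\<phi>. bc_transform \<nu> (bc_of_complex \<circ> \<phi>)) ` bargmann (\<nu> / 2) = bc_bargmann_i \<nu>
    \<and> (\<forall>n::nat. \<forall>Z. bc_transform \<nu> (\<lambda>\<xi>. bc_of_complex (\<xi> ^ n)) Z = bc_power Z n)"
proof (intro conjI allI)
  note [simp] = bc_transform_idem[OF assms]
  have T: "bc_transform \<nu> (\<lambda>\<xi>. bc_idem (\<phi> \<xi>) (\<psi> \<xi>)) = (\<lambda>Z. bc_idem (\<phi> (bc_alpha Z)) (\<psi> (bc_beta Z)))"
    if "\<phi> \<in> bargmann (\<nu> / 2)" "\<psi> \<in> bargmann (\<nu> / 2)" for \<phi> \<psi>
    using that by (simp add: fun_eq_iff)
  show "\<forall>F \<in> bargmann_bc (\<nu> / 2). \<forall>Z. integrable lborel (bc_transform_integrand \<nu> F Z)"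
    by (auto simp: bargmann_bc_def)
  show "bc_transform \<nu> ` bargmann_bc (\<nu> / 2) = bc_bargmann \<nu>"
    unfolding bc_bargmann_eq[OF assms] bargmann_bc_def
  proof (intro equalityI subsetI)
    fix f assume "f \<in> {\<lambda>Z. bc_idem (\<phi> (bc_alpha Z)) (\<psi> (bc_beta Z)) | \<phi> \<psi>.
      \<phi> \<in> bargmann (\<nu> / 2) \<and> \<psi> \<in> bargmann (\<nu> / 2)}"
    then obtain \<phi> \<psi> where *: "\<phi> \<in> bargmann (\<nu> / 2)" "\<psi> \<in> bargmann (\<nu> / 2)"
      "f = (\<lambda>Z. bc_idem (\<phi> (bc_alpha Z)) (\<psi> (bc_beta Z)))" by blast
    then show "f \<in> bc_transform \<nu> ` {\<lambda>\<xi>. bc_idem (\<phi> \<xi>) (\<psi> \<xi>) | \<phi> \<psi>. \<phi> \<in> bargmann (\<nu> / 2) \<and> \<psi> \<in> bargmann (\<nu> / 2)}"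
      by (intro image_eqI[where x="\<lambda>\<xi>. bc_idem (\<phi> \<xi>) (\<psi> \<xi>)"]) (auto simp: T)
  next
    fix f assume "f \<in> bc_transform \<nu> ` {\<lambda>\<xi>. bc_idem (\<phi> \<xi>) (\<psi> \<xi>) | \<phi> \<psi>. \<phi> \<in> bargmann (\<nu> / 2) \<and> \<psi> \<in> bargmann (\<nu> / 2)}"
    then obtain \<phi> \<psi> where *: "\<phi> \<in> bargmann (\<nu> / 2)" "\<psi> \<in> bargmann (\<nu> / 2)"
      "f = bc_transform \<nu> (\<lambda>\<xi>. bc_idem (\<phi> \<xi>) (\<psi> \<xi>))" by blast
    show "f \<in> {\<lambda>Z. bc_idem (\<phi> (bc_alpha Z)) (\<psi> (bc_beta Z)) | \<phi> \<psi>.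
      \<phi> \<in> bargmann (\<nu> / 2) \<and> \<psi> \<in> bargmann (\<nu> / 2)}"
      unfolding *(3) T[OF *(1,2)] using *(1,2) by (intro CollectI exI[of _ \<phi>] exI[of _ \<psi>] conjI refl)
  qed
  have T1: "bc_transform \<nu> (bc_of_complex \<circ> \<phi>) = (\<lambda>Z. bc_idem (\<phi> (bc_alpha Z)) (\<phi> (bc_beta Z)))"
    if "\<phi> \<in> bargmann (\<nu> / 2)" for \<phi>
    using T[OF that that] by (simp add: o_def bc_of_complex_eq_idem)
  show "(\<lambda>\<phi>. bc_transform \<nu> (bc_of_complex \<circ> \<phi>)) ` bargmann (\<nu> / 2) = bc_bargmann_i \<nu>"
  proof (intro equalityI subsetI)
    fix f assume "f \<in> (\<lambda>\<phi>. bc_transform \<nu> (bc_of_complex \<circ> \<phi>)) ` bargmann (\<nu> / 2)"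
    then obtain \<phi> where \<phi>: "\<phi> \<in> bargmann (\<nu> / 2)" "f = (\<lambda>Z. bc_idem (\<phi> (bc_alpha Z)) (\<phi> (bc_beta Z)))"
      using T1 by auto
    have "f (bc_of_complex z) = bc_of_complex (\<phi> z)" for z
      by (simp add: \<phi>(2) bc_of_complex_eq_idem)
    with \<phi> show "f \<in> bc_bargmann_i \<nu>"
      unfolding bc_bargmann_i_def bc_bargmann_eq[OF assms] by auto
  next
    fix f assume f: "f \<in> bc_bargmann_i \<nu>"
    then obtain \<phi> \<psi> where *: "\<phi> \<in> bargmann (\<nu> / 2)" "\<psi> \<in> bargmann (\<nu> / 2)"
      "f = (\<lambda>Z. bc_idem (\<phi> (bc_alpha Z)) (\<psi> (bc_beta Z)))"
      unfolding bc_bargmann_i_def bc_bargmann_eq[OF assms] by auto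
    have "\<phi> z = \<psi> z" for z
    proof -
      obtain w where "f (bc_of_complex z) = bc_of_complex w"
        using f unfolding bc_bargmann_i_def by blast
      then show ?thesis
        by (auto simp: *(3) bc_of_complex_eq_idem bc_eq_iff)
    qed
    then have "\<psi> = \<phi>" by (intro ext) simp
    then show "f \<in> (\<lambda>\<phi>. bc_transform \<nu> (bc_of_complex \<circ> \<phi>)) ` bargmann (\<nu> / 2)"
      using * T1 by (intro image_eqI[where x=\<phi>]) auto
  qed
  show "bc_transform \<nu> (\<lambda>\<xi>. bc_of_complex (\<xi> ^ n)) Z = bc_power Z n" for n Z
    using power_in_bargmann[of "\<nu> / 2" n] assms
    by (simp add: bc_of_complex_eq_idem bc_power_eq_idem)
qed

end
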